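(* Let $A\in Gl(d,\mathbb{R})$, $B\in\mathbb{R}^{d\times m}$, and let $U\subset\mathbb{R}^m$ be a convex compact neighborhood of $0$ with $U=\overline{\mathrm{int}\,U}$. Consider the system $x_{k+1}=Ax_k+Bu_k$, $u_k\in U$, $k\in\mathbb{N}_0$, with $(A,B)$ controllable, and let $D$ be its unique control set with nonvoid interior. Let $K\subset D$ be compact and assume that both $K$ and $D$ have positive and finite Lebesgue measure. Then for every $f\in C(U,\mathbb{R})$ $$P_{inv}(f,K,D)\ge\log|\det A^+|+\inf_{(\tau,x,u)}\frac1\tau\sum_{i=0}^{\tau-1}f(u_i),$$ where the infimum is taken over all $(\tau,x,u)\in\mathbb{N}\times D\times\mathcal{U}$ with $\tau\ge d$ and $\pi\varphi(i,x,u)\in\pi D$ for $i\in\{0,1,\dots,\tau-1\}$.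
   Context: $\mathbb{N}=\{1,2,\dots\}$, $\mathbb{N}_0=\{0,1,2,\dots\}$, $\mathcal{U}=U^{\mathbb{N}_0}$. For $x\in\mathbb{R}^d$, $u=(u_i)\in\mathcal{U}$ the solution is $\varphi(k,x,u)=A^kx+\sum_{i=0}^{k-1}A^{k-1-i}Bu_i$. The reachable set is $\mathbf{R}(x)=\{\varphi(k,x,u)\mid k\in\mathbb{N},u\in\mathcal{U}\}$. $(A,B)$ is controllable if $\mathrm{rank}[B\ AB\ \cdots\ A^{d-1}B]=d$. A nonvoid set $D\subset\mathbb{R}^d$ is a control set if it is maximal (with respect to inclusion) with the properties: (i) $D\subset\overline{\mathbf{R}(x)}$ for all $x\in D$; (ii) for every $x\in D$ there is $u\in\mathcal{U}$ with $\varphi(k,x,u)\in D$ for all $k\in\mathbb{N}$. When $(A,B)$ is controllable there is exactly one control set with nonvoid interior. $E^{sc}$ and $E^u$ are the direct sums of all generalized real eigenspaces of $A$ for the eigenvalues with $|\lambda|\le1$ and $|\lambda|>1$, respectively; $\pi:\mathbb{R}^d\to E^u$ is the projection along $E^{sc}$. $A^+$ is the restriction of $A$ to $E^u$; thus $\log|\det A^+|=\sum_{\lambda\in\sigma(A)}n_\lambda\max\{0,\log|\lambda|\}$, where $n_\lambda$ is the algebraic multiplicity of $\lambda$. For $\tau\in\mathbb{N}$, a set $\mathcal{S}\subset\mathcal{U}$ is $(\tau,K,D)$-spanning if for all $x\in K$ there is $u\in\mathcal{S}$ with $\varphi(k,x,u)\in D$ for all $k\in\{1,\dots,\tau\}$.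 For $f\in C(U,\mathbb{R})$ put $(S_\tau f)(u)=\sum_{i=0}^{\tau-1}f(u_i)$, $a_\tau(f,K,D)=\inf\{\sum_{u\in\mathcal{S}}e^{(S_\tau f)(u)}\mid\mathcal{S}\ (\tau,K,D)\text{-spanning}\}$, and $P_{inv}(f,K,D)=\limsup_{\tau\to\infty}\frac1\tau\log a_\tau(f,K,D)$. *)

theory Defs
  imports "HOL-Analysis.Analysis" "HOL-Combinatorics.Permutations"
begin

text \<open>The multiplication (and hence the power) of the type class instance on vectors is
  componentwise, so powers of square matrices are defined here with respect to the matrix product.\<close>

primrec mat_pow :: "'a::semiring_1^'n^'n \<Rightarrow> nat \<Rightarrow> 'a^'n^'n" where
  "mat_pow A 0 = mat 1"
| "mat_pow A (Suc k) = A ** mat_pow A k"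

definition controls :: "(real^'m) set \<Rightarrow> (nat \<Rightarrow> real^'m) set" where
  "controls U = {u. \<forall>i. u i \<in> U}"

definition trajectory ::
  "real^'d^'d \<Rightarrow> real^'m^'d \<Rightarrow> nat \<Rightarrow> real^'d \<Rightarrow> (nat \<Rightarrow> real^'m) \<Rightarrow> real^'d" where
  "trajectory A B k x u = mat_pow A k *v x + (\<Sum>i<k. (mat_pow A (k - 1 - i) ** B) *v u i)"

definition reachable_set ::
  "real^'d^'d \<Rightarrow> real^'m^'d \<Rightarrow> (real^'m) set \<Rightarrow> real^'d \<Rightarrow> (real^'d) set" where
  "reachable_set A B U x = {trajectory A B k x u | k u. 1 \<le> k \<and> u \<in> controls U}"

text \<open>The block matrix with blocks \<open>A\<^sup>j B\<close> for \<open>j < CARD('d)\<close>. Its columns are indexed by pairs: the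
  first component is a block number, encoded in the \<open>d\<close>-element type \<open>'d\<close> via the bijection
  \<open>to_nat_on UNIV\<close> onto \<open>{..<CARD('d)}\<close>, the second one is a column of the block.\<close>

definition kalman_matrix :: "real^'d^'d \<Rightarrow> real^'m^'d \<Rightarrow> real^('d \<times> 'm)^'d" where
  "kalman_matrix A B =
     (\<chi> i jl. (mat_pow A (to_nat_on (UNIV :: 'd set) (fst jl)) ** B) $ i $ snd jl)"

lemma columns_kalman_matrix:
  fixes A :: "real^'d^'d" and B :: "real^'m^'d"
  shows "columns (kalman_matrix A B) = (\<Union>k<CARD('d). columns (mat_pow A k ** B))"
proof -
  have range: "range (to_nat_on (UNIV :: 'd set)) = {..<CARD('d)}"
    using to_nat_on_finite[of "UNIV :: 'd set"] by (simp add: bij_betw_def)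
  have col: "column (j, l) (kalman_matrix A B) =
      column l (mat_pow A (to_nat_on (UNIV :: 'd set) j) ** B)" for j l
    by (simp add: column_def kalman_matrix_def vec_eq_iff)
  have "columns (kalman_matrix A B) =
      (\<Union>k\<in>range (to_nat_on (UNIV :: 'd set)). columns (mat_pow A k ** B))"
    by (auto simp: columns_def col)
  then show ?thesis
    unfolding range .
qed

definition controllable :: "real^'d^'d \<Rightarrow> real^'m^'d \<Rightarrow> bool" where
  "controllable A B \<longleftrightarrow> rank (kalman_matrix A B) = CARD('d)"

definition control_set_properties ::
  "real^'d^'d \<Rightarrow> real^'m^'d \<Rightarrow> (real^'m) set \<Rightarrow> (real^'d) set \<Rightarrow> bool" where
  "control_set_properties A B U D \<longleftrightarrow>
     (\<forall>x\<in>D. D \<subseteq> closure (reachable_set A B U x)) \<and>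
     (\<forall>x\<in>D. \<exists>u\<in>controls U. \<forall>k\<ge>1. trajectory A B k x u \<in> D)"

definition control_set ::
  "real^'d^'d \<Rightarrow> real^'m^'d \<Rightarrow> (real^'m) set \<Rightarrow> (real^'d) set \<Rightarrow> bool" where
  "control_set A B U D \<longleftrightarrow>
     D \<noteq> {} \<and> control_set_properties A B U D \<and>
     (\<forall>D'. D \<subseteq> D' \<and> control_set_properties A B U D' \<longrightarrow> D' = D)"

definition complexify :: "real^'n^'m \<Rightarrow> complex^'n^'m" where
  "complexify A = map_matrix complex_of_real A"

definition spectrum :: "real^'d^'d \<Rightarrow> complex set" where
  "spectrum A = {l. \<exists>v. v \<noteq> 0 \<and> complexify A *v v = l *s v}"

definition gen_eigenspace :: "real^'d^'d \<Rightarrow> complex \<Rightarrow> (complex^'d) set" where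
  "gen_eigenspace A l = {v. \<exists>k. mat_pow (complexify A - mat l) k *v v = 0}"

text \<open>Real and imaginary parts of complex generalized eigenvectors. As \<open>gen_eigenspace A l\<close> is closed
  under multiplication by \<open>\<i>\<close>, this is a real subspace; it is the same for \<open>l\<close> and \<open>cnj l\<close>.\<close>

definition real_gen_eigenspace :: "real^'d^'d \<Rightarrow> complex \<Rightarrow> (real^'d) set" where
  "real_gen_eigenspace A l =
     {(\<chi> i. Re (v $ i)) | v. v \<in> gen_eigenspace A l} \<union>
     {(\<chi> i. Im (v $ i)) | v. v \<in> gen_eigenspace A l}"

definition E_sc :: "real^'d^'d \<Rightarrow> (real^'d) set" where
  "E_sc A = span (\<Union>l\<in>{l \<in> spectrum A. cmod l \<le> 1}. real_gen_eigenspace A l)"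

definition E_u :: "real^'d^'d \<Rightarrow> (real^'d) set" where
  "E_u A = span (\<Union>l\<in>{l \<in> spectrum A. cmod l > 1}. real_gen_eigenspace A l)"

definition unstable_proj :: "real^'d^'d \<Rightarrow> real^'d \<Rightarrow> real^'d" where
  "unstable_proj A x = (THE y. y \<in> E_u A \<and> x - y \<in> E_sc A)"

text \<open>Determinant of a linear map restricted to an invariant subspace \<open>V\<close>: the Leibniz formula for
  the matrix of the restriction with respect to a basis \<open>b\<close> of \<open>V\<close>, with rows and columns indexed
  by \<open>b\<close> itself. The value does not depend on \<open>b\<close>, and it is 1 for \<open>V = {0}\<close>.\<close>

definition det_on :: "'a::real_vector set \<Rightarrow> ('a \<Rightarrow> 'a) \<Rightarrow> real" where
  "det_on V g =
     (let b = (SOME b. independent b \<and> span b = V)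
      in \<Sum>p | p permutes b. of_int (sign p) * (\<Prod>v\<in>b. representation b (g v) (p v)))"

definition spanning ::
  "real^'d^'d \<Rightarrow> real^'m^'d \<Rightarrow> (real^'m) set \<Rightarrow> nat \<Rightarrow> (real^'d) set \<Rightarrow> (real^'d) set
    \<Rightarrow> (nat \<Rightarrow> real^'m) set \<Rightarrow> bool" where
  "spanning A B U t K D S \<longleftrightarrow>
     S \<subseteq> controls U \<and> (\<forall>x\<in>K. \<exists>u\<in>S. \<forall>k\<in>{1..t}. trajectory A B k x u \<in> D)"

definition birkhoff_sum :: "nat \<Rightarrow> ('b \<Rightarrow> real) \<Rightarrow> (nat \<Rightarrow> 'b) \<Rightarrow> real" where
  "birkhoff_sum t f u = (\<Sum>i<t. f (u i))"

text \<open>Spanning sets may be infinite, even uncountable: the sum is the unordered sum in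
  \<open>[0, \<infinity>]\<close>.\<close>

definition spanning_inf ::
  "real^'d^'d \<Rightarrow> real^'m^'d \<Rightarrow> (real^'m) set \<Rightarrow> nat \<Rightarrow> (real^'m \<Rightarrow> real)
    \<Rightarrow> (real^'d) set \<Rightarrow> (real^'d) set \<Rightarrow> ennreal" where
  "spanning_inf A B U t f K D =
     (INF S\<in>{S. spanning A B U t K D S}. \<Sum>\<^sub>\<infinity>u\<in>S. ennreal (exp (birkhoff_sum t f u)))"

definition ext_ln :: "ennreal \<Rightarrow> ereal" where
  "ext_ln x = (if x = 0 then -\<infinity> else if x = \<infinity> then \<infinity> else ereal (ln (enn2real x)))"

definition invariance_pressure ::
  "real^'d^'d \<Rightarrow> real^'m^'d \<Rightarrow> (real^'m) set \<Rightarrow> (real^'m \<Rightarrow> real)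
    \<Rightarrow> (real^'d) set \<Rightarrow> (real^'d) set \<Rightarrow> ereal" where
  "invariance_pressure A B U f K D =
     limsup (\<lambda>t. ereal (1 / real t) * ext_ln (spanning_inf A B U t f K D))"

end

theory Submission
  imports Defs "HOL-Computational_Algebra.Fundamental_Theorem_Algebra"
begin

text \<open>Outside a ball of a suitable norm on \<open>E\<^sup>u\<close> the unstable part of every trajectory grows,
  whereas the trajectories starting in a control set return arbitrarily close to their starting
  points; hence \<open>\<pi> D\<close> is bounded. If a control \<open>u\<close> keeps a set of initial values in \<open>D\<close> up to time
  \<open>\<tau>\<close>, then the map \<open>x \<mapsto> \<pi> \<phi>(\<tau>,x,u)\<close>, which is affine with linear part \<open>(A\<^sup>+)\<^sup>\<tau>\<close> on
  \<open>E\<^sup>u\<close>, sends it into \<open>\<pi> D\<close>. Comparing volumes, covering \<open>K\<close> takes at least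
  \<open>c \<bar>det A\<^sup>+\<bar>\<^sup>\<tau>\<close> such controls, and each of them contributes at least \<open>e\<^sup>\<tau>\<^sup>I\<close> to the sum, where
  \<open>I\<close> is the infimum of the averages.\<close>

section \<open>Root spaces of complex matrices\<close>

text \<open>Volumes under \<open>A\<close> itself would involve the full determinant, where
  eigenvalues inside the unit disc spoil the growth rate, while projecting \<open>K\<close> would
  require a volume on the subspace \<open>E_u A\<close>. The comparison therefore runs in the whole
  space with the map that equals \<open>A\<close> on \<open>E_u A\<close> and the identity on
  \<open>E_sc A\<close>. Both subspaces are spans of real and imaginary parts of complex generalized
  eigenvectors. Their complementarity and the growth on \<open>E_u A\<close> are proved over the
  complex numbers by stripping factors \<open>M - l\<close> one at a time, without a normal form.
  The suitable norm is the sum over all k of the norms of A^(-k) applied to the unstable component;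
  its convergence is the only place where \<open>cmod l > 1\<close> enters.\<close>

definition shift :: "complex^'d^'d \<Rightarrow> complex \<Rightarrow> complex^'d \<Rightarrow> complex^'d" where
  "shift M l v = M *v v - l *s v"

lemma scaleR_vec_complex: "r *\<^sub>R (v :: complex^'d) = complex_of_real r *s v"
  by (simp add: vec_eq_iff scaleR_conv_of_real[symmetric] scaleR_vec_def)

lemma shift_add: "shift M l (v + w) = shift M l v + shift M l w"
  by (simp add: shift_def algebra_simps)

lemma shift_scale: "shift M l (c *s v) = c *s shift M l v"
  by (simp add: shift_def vector_scalar_commute vec_eq_iff algebra_simps)

lemma shift_diff: "shift M l (v - w) = shift M l v - shift M l w"
  by (simp add: shift_def algebra_simps)

lemma shift_0 [simp]: "shift M l 0 = 0"
  by (simp add: shift_def)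

lemma shift_mult: "shift M l (M *v v) = M *v shift M l v"
  by (simp add: shift_def algebra_simps vector_scalar_commute)

lemma mat_pow_shift: "mat_pow (M - mat l) k *v v = (shift M l ^^ k) v"
proof (induction k)
  case (Suc k)
  have "mat l *v x = l *s x" for x :: "complex^'d"
    by (simp add: vec_eq_iff matrix_vector_mult_def mat_def if_distrib if_distribR cong: if_cong)
  then show ?case
    using Suc by (simp add: matrix_vector_mul_assoc[symmetric] matrix_vector_mult_diff_rdistrib shift_def)
qed simp

text \<open>The vectors annihilated by some product of factors \<open>M - l\<close> with \<open>l \<in> S\<close>, i.e. the sum of
  the generalized eigenspaces for \<open>l \<in> S\<close>. The inductive form makes its properties rule
  inductions.\<close>

inductive_set root_space :: "complex^'d^'d \<Rightarrow> complex set \<Rightarrow> (complex^'d) set"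
  for M :: "complex^'d^'d" and S :: "complex set" where
  zero: "0 \<in> root_space M S"
| shift: "l \<in> S \<Longrightarrow> shift M l v \<in> root_space M S \<Longrightarrow> v \<in> root_space M S"

lemma root_space_mult: "v \<in> root_space M S \<Longrightarrow> M *v v \<in> root_space M S"
proof (induction rule: root_space.induct)
  case zero then show ?case by (simp add: root_space.zero)
next
  case (shift l v)
  then show ?case by - (rule root_space.shift[of l], auto simp: shift_mult)
qed

lemma root_space_scale: "v \<in> root_space M S \<Longrightarrow> c *s v \<in> root_space M S"
proof (induction rule: root_space.induct)
  case zero then show ?case by (simp add: root_space.zero)
next
  case (shift l v)
  then show ?case by - (rule root_space.shift[of l], auto simp: shift_scale)
qed

text \<open>Factors \<open>M - l\<close> commute, so applying one that helps to kill
  \<open>v\<close> does not move \<open>w\<close> out of the root space. Hence \<open>w\<close>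
  stays arbitrary in the induction on \<open>v\<close>.\<close>

lemma root_space_add:
  assumes "v \<in> root_space M S" "w \<in> root_space M S"
  shows "v + w \<in> root_space M S"
  using assms
proof (induction arbitrary: w rule: root_space.induct)
  case (shift l v)
  have sub: "shift M l w \<in> root_space M S" if "w \<in> root_space M S" for w
    using that
  proof (induction rule: root_space.induct)
    case zero then show ?case by (simp add: root_space.zero)
  next
    case (shift n v)
    have "shift M n (shift M l v) = shift M l (shift M n v)"
      by (simp add: shift_def algebra_simps vector_scalar_commute vec_eq_iff)
    then show ?case using shift root_space.shift[of n S M "shift M l v"] by simp
  qed
  show ?case
    using shift sub[OF shift.prems] by - (rule root_space.shift[of l], auto simp: shift_add)
qed simp

lemma root_space_diff:
  assumes "v \<in> root_space M S" "w \<in> root_space M S"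
  shows "v - w \<in> root_space M S"
  using root_space_add[OF assms(1) root_space_scale[OF assms(2), of "-1"]] by simp

lemma root_space_shift: "v \<in> root_space M S \<Longrightarrow> shift M l v \<in> root_space M S"
  by (simp add: shift_def root_space_diff root_space_scale root_space_mult)

lemma subspace_root_space: "subspace (root_space M S)"
  by (simp add: subspace_def root_space.zero root_space_add scaleR_vec_complex root_space_scale)

lemma root_space_mono: "S \<subseteq> T \<Longrightarrow> root_space M S \<subseteq> root_space M T"
proof
  fix v assume "S \<subseteq> T" "v \<in> root_space M S"
  from this(2,1) show "v \<in> root_space M T"
    by (induction rule: root_space.induct) (auto intro: root_space.intros)
qed

text \<open>On an eigenvector for \<open>l\<close> each factor \<open>M - n\<close> with
  \<open>n \<in> S\<close> acts as the nonzero scalar \<open>l - n\<close>, so no product of such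
  factors kills it.\<close>

lemma root_space_eigenvector:
  assumes "v \<in> root_space M S" "M *v v = l *s v" "l \<notin> S"
  shows "v = 0"
  using assms
proof (induction rule: root_space.induct)
  case (shift n v)
  have eq: "shift M n v = (l - n) *s v"
    by (simp add: shift_def shift.prems vec_eq_iff algebra_simps)
  then have "M *v shift M n v = l *s shift M n v"
    using shift.prems(1) by (metis shift_mult shift_scale)
  then have "shift M n v = 0"
    using shift by blast
  then show ?case
    using eq shift by auto
qed simp

text \<open>By induction \<open>shift M l v\<close> already vanishes; then \<open>v\<close> is
  killed by \<open>M - l\<close> with \<open>l\<close> outside \<open>T\<close>, and the previous
  lemma applies to \<open>T\<close>.\<close>

lemma root_space_disjoint:
  assumes "v \<in> root_space M S" "v \<in> root_space M T" "S \<inter> T = {}"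
  shows "v = 0"
  using assms
proof (induction rule: root_space.induct)
  case (shift l v)
  then have "shift M l v = 0"
    using root_space_shift by blast
  then show ?case
    using shift by (intro root_space_eigenvector[of v M T l]) (auto simp: shift_def)
qed simp

text \<open>\<open>M - l\<close> and \<open>M - n\<close> differ by the nonzero scalar
  \<open>n - l\<close>. If \<open>v\<close> is a preimage of \<open>shift M n w\<close>, then
  \<open>M - l\<close> sends \<open>w - v\<close> to \<open>(n - l) *s w\<close>.\<close>

lemma root_space_shift_surj:
  assumes "w \<in> root_space M S" "l \<notin> S"
  shows "\<exists>v\<in>root_space M S. shift M l v = w"
  using assms
proof (induction rule: root_space.induct)
  case zero
  show ?case by (rule bexI[of _ 0]) (simp_all add: root_space.zero)
next
  case (shift n w)
  then obtain v where v: "v \<in> root_space M S" "shift M l v = shift M n w" by blast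
  have w: "w \<in> root_space M S" using shift root_space.shift by blast
  have nz: "n - l \<noteq> 0" using shift by auto
  have "shift M l (w - v) = (n - l) *s w"
    using v(2) by (simp add: shift_diff) (simp add: shift_def vec_eq_iff algebra_simps)
  then have "shift M l ((1 / (n - l)) *s (w - v)) = w"
    unfolding shift_scale using nz by (simp only: vector_smult_assoc) simp
  then show ?case
    using v w by (meson root_space_diff root_space_scale)
qed

text \<open>For the harder inclusion, \<open>shift M l v\<close> lies in the span by induction and
  is pulled back through \<open>M - l\<close>. Summands for \<open>n\<close> different from
  \<open>l\<close> have exact preimages; those for \<open>l\<close> are ignored, since an error in
  \<open>root_space M {l}\<close> only changes the component of \<open>v\<close> there.\<close>

lemma root_space_eq_span:
  "root_space M S = span (\<Union>l\<in>S. root_space M {l})" (is "_ = span ?G")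
proof
  show "span ?G \<subseteq> root_space M S"
  proof (rule span_minimal[OF _ subspace_root_space])
    show "?G \<subseteq> root_space M S"
      using root_space_mono[of "{l}" S M for l] by blast
  qed
  show "root_space M S \<subseteq> span ?G"
  proof
    fix v assume "v \<in> root_space M S"
    then show "v \<in> span ?G"
    proof (induction rule: root_space.induct)
      case (shift l v)
      have "\<exists>v'\<in>span ?G. shift M l v' - w \<in> root_space M {l}" if "w \<in> span ?G" for w
        using that
      proof (induction rule: span_induct_alt)
        case base
        show ?case by (intro bexI[of _ 0]) (simp_all add: root_space.zero span_zero)
      next
        case (step c x y)
        then obtain n where n: "n \<in> S" "x \<in> root_space M {n}" by blast
        obtain y' where y': "y' \<in> span ?G" "shift M l y' - y \<in> root_space M {l}"
          using step by blast
        obtain x' where x': "x' \<in> span ?G" "shift M l x' - x \<in> root_space M {l}"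
        proof (cases "n = l")
          case True
          show ?thesis
            using n True root_space_diff[OF root_space.zero, of x M "{l}"]
            by (intro that[of 0]) (auto simp: span_zero)
        next
          case False
          then obtain x' where "x' \<in> root_space M {n}" "shift M l x' = x"
            using root_space_shift_surj[OF n(2), of l] by auto
          then show ?thesis
            using n(1) by (intro that[of x']) (auto simp: root_space.zero intro!: span_base)
        qed
        show ?case
        proof (intro bexI[of _ "c *\<^sub>R x' + y'"])
          have "shift M l (c *\<^sub>R x' + y') - (c *\<^sub>R x + y) =
              c *\<^sub>R (shift M l x' - x) + (shift M l y' - y)"
            by (simp add: shift_add scaleR_vec_complex shift_scale vec_eq_iff algebra_simps)
          then show "shift M l (c *\<^sub>R x' + y') - (c *\<^sub>R x + y) \<in> root_space M {l}"
            using x' y' by (simp only: root_space_add root_space_scale scaleR_vec_complex)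
        qed (use x' y' in \<open>auto intro: span_add span_scale\<close>)
      qed
      then obtain v' where v': "v' \<in> span ?G" "shift M l v' - shift M l v \<in> root_space M {l}"
        using shift by blast
      then have "v' - v \<in> root_space M {l}"
        by - (rule root_space.shift[of l], auto simp: shift_diff)
      then have "v' - v \<in> span ?G"
        using shift(1) by (blast intro: span_base)
      then show ?case
        using span_diff[OF v'(1)] by fastforce
    qed (rule span_zero)
  qed
qed

section \<open>Annihilating polynomials of a vector\<close>

definition poly_vec :: "complex^'d^'d \<Rightarrow> complex poly \<Rightarrow> complex^'d \<Rightarrow> complex^'d" where
  "poly_vec M p v = (\<Sum>i\<le>degree p. coeff p i *s (mat_pow M i *v v))"

lemma poly_vec_ge:
  assumes "degree p \<le> n"
  shows "poly_vec M p v = (\<Sum>i\<le>n. coeff p i *s (mat_pow M i *v v))"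
  unfolding poly_vec_def
  by (rule sum.mono_neutral_left) (use assms in \<open>auto simp: coeff_eq_0\<close>)

lemma mat_pow_commute: "mat_pow M k ** M = M ** mat_pow M k"
  by (induction k) (simp_all add: matrix_mul_assoc[symmetric])

lemma poly_vec_linear_factor:
  "poly_vec M ([:- l, 1:] * q) v = poly_vec M q (shift M l v)"
proof -
  define n where "n = degree q"
  have deg: "degree ([:- l, 1:] * q) \<le> Suc n"
    using degree_mult_le[of "[:- l, 1:]" q] by (simp add: n_def)
  have co: "coeff ([:- l, 1:] * q) i = (case i of 0 \<Rightarrow> 0 | Suc j \<Rightarrow> coeff q j) - l * coeff q i" for i
    by (simp add: coeff_pCons split: nat.split)
  have 1: "(\<Sum>i\<le>Suc n. (case i of 0 \<Rightarrow> 0 | Suc j \<Rightarrow> coeff q j) *s (mat_pow M i *v v))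
      = poly_vec M q (M *v v)"
    unfolding poly_vec_ge[of q n, OF eq_refl[OF n_def[symmetric]]] sum.atMost_Suc_shift
    by (simp add: matrix_vector_mul_assoc mat_pow_commute)
  have 2: "(\<Sum>i\<le>Suc n. (l * coeff q i) *s (mat_pow M i *v v)) = l *s poly_vec M q v"
    unfolding poly_vec_ge[of q "Suc n", OF le_SucI[OF eq_refl[OF n_def[symmetric]]]]
    by (simp add: vec.scale_sum_right)
  have "poly_vec M ([:- l, 1:] * q) v = poly_vec M q (M *v v) - l *s poly_vec M q v"
    unfolding poly_vec_ge[OF deg] co vec.scale_left_diff_distrib sum_subtractf 1 2 ..
  also have "\<dots> = poly_vec M q (shift M l v)"
    unfolding poly_vec_def shift_def
    by (simp add: vec.scale_sum_right algebra_simps vec.scale_right_diff_distrib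
        sum_subtractf vector_scalar_commute)
  finally show ?thesis .
qed

text \<open>A nonconstant complex polynomial has a linear factor, and removing it is one application
  of the rule \<open>root_space.shift\<close>.\<close>

lemma root_space_if_poly_vec:
  assumes "p \<noteq> 0" "poly_vec M p v = 0"
  shows "v \<in> root_space M UNIV"
  using assms
proof (induction "degree p" arbitrary: p v rule: less_induct)
  case less
  show ?case
  proof (cases "degree p = 0")
    case True
    then obtain c where "p = [:c:]" by (rule degree_eq_zeroE)
    then have "v = 0" using less.prems by (simp add: poly_vec_def)
    then show ?thesis by (simp add: root_space.zero)
  next
    case False
    then obtain l where "poly p l = 0"
      using fundamental_theorem_of_algebra[of p] constant_degree[of p] by auto
    then obtain q where q: "p = [:- l, 1:] * q"
      by (metis poly_eq_0_iff_dvd dvdE)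
    then have q0: "q \<noteq> 0" using less.prems by auto
    have "degree p = Suc (degree q)"
      unfolding q using q0 by (subst degree_mult_eq) auto
    moreover have "poly_vec M q (shift M l v) = 0"
      using less.prems(2) unfolding q poly_vec_linear_factor .
    ultimately have "shift M l v \<in> root_space M UNIV"
      using less.hyps[of q] q0 by simp
    then show ?thesis by (rule root_space.shift[OF UNIV_I])
  qed
qed

text \<open>The \<open>n + 1\<close> iterates of \<open>v\<close> are linearly dependent,
  \<open>n\<close> being the real dimension; a relation with real coefficients is enough. The
  polynomial may depend on \<open>v\<close>.\<close>

lemma ex_annihilating_poly: "\<exists>p. p \<noteq> 0 \<and> poly_vec M p v = 0"
proof -
  define n where "n = DIM(complex^'a)"
  define w where "w i = mat_pow M i *v v" for i
  show ?thesis
  proof (cases "inj_on w {..n}")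
    \<comment> \<open>With a repetition the set of iterates is smaller and may be independent, but
      the coincidence itself gives the polynomial X^i - X^j.\<close>
    case False
    then obtain i j where ij: "i \<noteq> j" "w i = w j" by (auto simp: inj_on_def)
    define p :: "complex poly" where "p = monom 1 i - monom 1 j"
    have "coeff p i \<noteq> 0" using ij by (simp add: p_def)
    then have "p \<noteq> 0" by auto
    moreover have "degree p \<le> max i j"
      unfolding p_def by (intro degree_diff_le order_trans[OF degree_monom_le]) auto
    then have "poly_vec M p v =
        (\<Sum>k\<le>max i j. (if i = k then w k else 0) - (if j = k then w k else 0))"
      unfolding poly_vec_ge[OF \<open>degree p \<le> max i j\<close>]
      by (intro sum.cong) (auto simp: p_def w_def)
    then have "poly_vec M p v = 0"
      using ij by (simp add: sum_subtractf)
    ultimately show ?thesis by blast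
  next
    case True
    have "dependent (w ` {..n})"
      using independent_bound[of "w ` {..n}"] card_image[OF True] by (auto simp: n_def)
    then obtain c where c: "(\<Sum>x\<in>w ` {..n}. c x *\<^sub>R x) = 0" "\<exists>x\<in>w ` {..n}. c x \<noteq> 0"
      by (auto simp: dependent_finite)
    define p :: "complex poly" where "p = (\<Sum>i\<le>n. monom (complex_of_real (c (w i))) i)"
    have co: "coeff p i = (if i \<le> n then complex_of_real (c (w i)) else 0)" for i
      by (simp add: p_def coeff_sum)
    obtain i where "i \<le> n" "c (w i) \<noteq> 0" using c(2) by blast
    then have "coeff p i \<noteq> 0" by (simp add: co)
    then have "p \<noteq> 0" by auto
    moreover have "degree p \<le> n"
      by (rule degree_le) (simp add: co)
    then have "poly_vec M p v = (\<Sum>i\<le>n. c (w i) *\<^sub>R w i)"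
      by (simp add: poly_vec_ge co w_def scaleR_vec_complex)
    then have "poly_vec M p v = 0"
      using c(1) by (simp add: sum.reindex[OF True])
    ultimately show ?thesis by blast
  qed
qed

lemma root_space_UNIV: "root_space M UNIV = UNIV"
  using ex_annihilating_poly root_space_if_poly_vec by blast

text \<open>A vector with \<open>M v = l v + w\<close> satisfies \<open>M\<^sup>-\<^sup>1 v = (v - M\<^sup>-\<^sup>1 w) / l\<close>, which turns
  summability for \<open>w\<close> into summability for \<open>v\<close> as \<open>cmod l > 1\<close>.\<close>

lemma summable_root_space:
  fixes M M' :: "complex^'d^'d"
  assumes "v \<in> root_space M S" and S: "\<And>l. l \<in> S \<Longrightarrow> cmod l > 1" and inv: "M' ** M = mat 1"
  shows "summable (\<lambda>k. norm (mat_pow M' k *v v))"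
  using assms(1)
proof (induction rule: root_space.induct)
  case (shift l v)
  define a b where "a k = norm (mat_pow M' k *v v)" and
    "b k = norm (mat_pow M' k *v shift M l v)" for k
  have l: "cmod l > 1" using shift S by blast
  have "M' *v (M *v v) = v"
    by (simp add: matrix_vector_mul_assoc inv)
  then have "v = l *s (M' *v v) + M' *v shift M l v"
    by (simp add: shift_def algebra_simps vector_scalar_commute)
  then have "mat_pow M' k *v v =
      l *s (mat_pow M' (Suc k) *v v) + mat_pow M' (Suc k) *v shift M l v" for k
    by (metis (no_types, lifting) mat_pow.simps(2) mat_pow_commute matrix_vector_mul_assoc
        matrix_vector_right_distrib vector_scalar_commute)
  moreover have "norm (l *s x) = cmod l * norm x" for x :: "complex^'d"
    by (simp add: norm_vec_def L2_set_def norm_mult power_mult_distrib sum_distrib_left[symmetric]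
        real_sqrt_mult)
  ultimately have rec: "cmod l * a (Suc k) \<le> a k + b (Suc k)" for k
    unfolding a_def b_def by (metis add_diff_cancel_right' norm_triangle_ineq4)
  have b: "summable b" using shift by (simp add: b_def[abs_def])
  have a0: "a k \<ge> 0" and b0: "b k \<ge> 0" for k by (simp_all add: a_def b_def)
  \<comment> \<open>Summing \<open>rec\<close> bounds the shifted sum of \<open>a\<close> in terms
    of itself; it is absorbed on the left because \<open>cmod l > 1\<close>, which leaves a bound
    independent of \<open>n\<close>.\<close>
  have "(cmod l - 1) * (\<Sum>k<n. a (Suc k)) \<le> a 0 + suminf b" for n
  proof -
    have "cmod l * (\<Sum>k<n. a (Suc k)) \<le> (\<Sum>k<n. a k) + (\<Sum>k<n. b (Suc k))"
      unfolding sum_distrib_left sum.distrib[symmetric] by (intro sum_mono rec)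
    moreover have "(\<Sum>k<n. a k) \<le> a 0 + (\<Sum>k<n. a (Suc k))"
      using sum.lessThan_Suc_shift[of a n] a0[of n] by simp
    moreover have "(\<Sum>k<n. b (Suc k)) \<le> suminf b"
    proof -
      have "(\<Sum>k<Suc n. b k) \<le> suminf b" using b b0 by (intro sum_le_suminf) auto
      then show ?thesis using b0[of 0] unfolding sum.lessThan_Suc_shift by linarith
    qed
    ultimately show ?thesis by (simp add: algebra_simps)
  qed
  then have "(\<Sum>k<n. a (Suc k)) \<le> (a 0 + suminf b) / (cmod l - 1)" for n
    using l by (simp add: field_simps)
  then have "summable (\<lambda>k. a (Suc k))"
    using a0 by (intro summableI_nonneg_bounded) auto
  then have "summable a" by (simp only: summable_Suc_iff)
  then show ?case by (simp add: a_def[abs_def])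
qed (simp add: summable_zero)

section \<open>The real spectral decomposition\<close>

definition of_real_vec :: "real^'d \<Rightarrow> complex^'d" where
  "of_real_vec x = (\<chi> i. complex_of_real (x $ i))"

definition Re_vec :: "complex^'d \<Rightarrow> real^'d" where "Re_vec v = (\<chi> i. Re (v $ i))"
definition Im_vec :: "complex^'d \<Rightarrow> real^'d" where "Im_vec v = (\<chi> i. Im (v $ i))"
definition cnj_vec :: "complex^'d \<Rightarrow> complex^'d" where "cnj_vec v = (\<chi> i. cnj (v $ i))"

lemma linear_of_real_vec: "linear of_real_vec"
  by (rule linearI) (simp_all add: of_real_vec_def vec_eq_iff scaleR_conv_of_real[where 'a=complex])

lemma linear_Re_vec: "linear Re_vec"
  by (rule linearI) (simp_all add: Re_vec_def vec_eq_iff)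

lemma Re_of_real_vec [simp]: "Re_vec (of_real_vec x) = x"
  by (simp add: Re_vec_def of_real_vec_def vec_eq_iff)

lemma norm_of_real_vec: "norm (of_real_vec x) = norm x"
  by (simp add: norm_vec_def L2_set_def of_real_vec_def)

lemma complexify_of_real_vec: "complexify M *v of_real_vec x = of_real_vec (M *v x)"
  by (simp add: complexify_def map_matrix_def of_real_vec_def matrix_vector_mult_def vec_eq_iff)

lemma Re_vec_complexify: "Re_vec (complexify M *v v) = M *v Re_vec v"
  by (simp add: complexify_def map_matrix_def Re_vec_def matrix_vector_mult_def vec_eq_iff)

lemma Im_vec_complexify: "Im_vec (complexify M *v v) = M *v Im_vec v"
  by (simp add: complexify_def map_matrix_def Im_vec_def matrix_vector_mult_def vec_eq_iff)

lemma mat_pow_complexify_of_real_vec: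
  "mat_pow (complexify M) k *v of_real_vec x = of_real_vec (mat_pow M k *v x)"
  by (induction k) (simp_all add: matrix_vector_mul_assoc[symmetric] complexify_of_real_vec)

lemma complexify_mult: "complexify (M ** N) = complexify M ** complexify N"
  by (simp add: complexify_def map_matrix_def matrix_matrix_mult_def vec_eq_iff)

lemma complexify_mat_1: "complexify (mat 1) = mat 1"
  by (simp add: complexify_def map_matrix_def mat_def vec_eq_iff)

lemma cnj_vec_root_space:
  assumes "v \<in> root_space (complexify A) S"
  shows "cnj_vec v \<in> root_space (complexify A) (cnj ` S)"
  using assms
proof (induction rule: root_space.induct)
  case zero
  have "cnj_vec 0 = (0 :: complex^'a)" by (simp add: cnj_vec_def vec_eq_iff)
  then show ?case by (simp add: root_space.zero)
next
  case (shift l v)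
  have "cnj_vec (shift (complexify A) l v) = shift (complexify A) (cnj l) (cnj_vec v)"
    by (simp add: cnj_vec_def shift_def complexify_def map_matrix_def matrix_vector_mult_def vec_eq_iff)
  then show ?case
    using shift root_space.shift[of "cnj l" "cnj ` S" "complexify A" "cnj_vec v"] by auto
qed

lemma gen_eigenspace_eq: "gen_eigenspace A l = root_space (complexify A) {l}"
proof safe
  fix v assume "v \<in> gen_eigenspace A l"
  then obtain k where "(shift (complexify A) l ^^ k) v = 0"
    by (auto simp: gen_eigenspace_def mat_pow_shift)
  then show "v \<in> root_space (complexify A) {l}"
  proof (induction k arbitrary: v)
    case (Suc k)
    then have "shift (complexify A) l v \<in> root_space (complexify A) {l}"
      by (simp add: funpow_swap1)
    then show ?case by - (rule root_space.shift[of l], auto)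
  qed (auto simp: root_space.zero)
next
  fix v assume "v \<in> root_space (complexify A) {l}"
  then have "\<exists>k. (shift (complexify A) l ^^ k) v = 0"
  proof (induction rule: root_space.induct)
    case zero
    show ?case by (rule exI[of _ 0]) simp
  next
    case (shift n v)
    then obtain k where "(shift (complexify A) l ^^ k) (shift (complexify A) l v) = 0" by auto
    then show ?case by (intro exI[of _ "Suc k"]) (simp add: funpow_swap1)
  qed
  then show "v \<in> gen_eigenspace A l"
    by (simp add: gen_eigenspace_def mat_pow_shift)
qed

text \<open>Lets sums over all complex numbers be restricted to eigenvalues: the last nonzero vector
  of a chain of shifts would be an eigenvector.\<close>

lemma gen_eigenspace_not_spectrum:
  assumes "l \<notin> spectrum A" "v \<in> gen_eigenspace A l"
  shows "v = 0"
proof -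
  have "v \<in> root_space (complexify A) {l}"
    using assms(2) by (simp add: gen_eigenspace_eq)
  then show ?thesis
  proof (induction rule: root_space.induct)
    case (shift n v)
    then have "complexify A *v v = l *s v"
      by (simp add: shift_def)
    then show ?case using assms(1) by (auto simp: spectrum_def)
  qed simp
qed

section \<open>Real invariant subspaces belonging to sets of eigenvalues\<close>

definition spectral_subspace :: "real^'d^'d \<Rightarrow> complex set \<Rightarrow> (real^'d) set" where
  "spectral_subspace A S = span (\<Union>l\<in>{l \<in> spectrum A. l \<in> S}. real_gen_eigenspace A l)"

lemma E_u_eq: "E_u A = spectral_subspace A {l. cmod l > 1}"
  and E_sc_eq: "E_sc A = spectral_subspace A {l. cmod l \<le> 1}"
  by (simp_all add: E_u_def E_sc_def spectral_subspace_def)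

lemma real_gen_eigenspace_eq:
  "real_gen_eigenspace A l = Re_vec ` gen_eigenspace A l \<union> Im_vec ` gen_eigenspace A l"
  unfolding real_gen_eigenspace_def Re_vec_def Im_vec_def by blast

lemma subspace_spectral_subspace: "subspace (spectral_subspace A S)"
  by (simp add: spectral_subspace_def)

lemma spectral_subspace_mult:
  assumes "x \<in> spectral_subspace A S"
  shows "A *v x \<in> spectral_subspace A S"
proof -
  let ?G = "\<Union>l\<in>{l \<in> spectrum A. l \<in> S}. real_gen_eigenspace A l"
  have "(*v) A ` real_gen_eigenspace A l \<subseteq> real_gen_eigenspace A l" for l
    by (auto simp: real_gen_eigenspace_eq gen_eigenspace_eq root_space_mult
        simp flip: Re_vec_complexify Im_vec_complexify)
  then have "(*v) A ` ?G \<subseteq> ?G" by blast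
  then have "span ((*v) A ` ?G) \<subseteq> span ?G" by (rule span_mono)
  then have "(*v) A ` span ?G \<subseteq> span ?G" by (simp add: linear_span_image)
  then show ?thesis using assms by (auto simp: spectral_subspace_def)
qed

text \<open>Real and imaginary parts of \<open>v\<close> are combinations of \<open>v\<close> and
  \<open>cnj_vec v\<close>, and the closure of \<open>S\<close> under conjugation keeps both in one
  root space. Disjointness and summability can thus be transferred from the complex side.\<close>

lemma of_real_vec_spectral_subspace:
  assumes "x \<in> spectral_subspace A S" and S: "cnj ` S \<subseteq> S"
  shows "of_real_vec x \<in> root_space (complexify A) S"
proof -
  let ?R = "root_space (complexify A) S"
  have "subspace (of_real_vec -` ?R)"
    by (intro linear_subspace_vimage linear_of_real_vec subspace_root_space)
  moreover have "(\<Union>l\<in>{l \<in> spectrum A. l \<in> S}. real_gen_eigenspace A l) \<subseteq> of_real_vec -` ?R"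
  proof
    fix x assume "x \<in> (\<Union>l\<in>{l \<in> spectrum A. l \<in> S}. real_gen_eigenspace A l)"
    then obtain l where l: "l \<in> S" "x \<in> real_gen_eigenspace A l" by blast
    then obtain v where v: "v \<in> root_space (complexify A) {l}" "x = Re_vec v \<or> x = Im_vec v"
      by (auto simp: real_gen_eigenspace_eq gen_eigenspace_eq)
    have "v \<in> ?R"
      using v(1) l(1) root_space_mono[of "{l}" S "complexify A"] by auto
    moreover have "cnj_vec v \<in> ?R"
      using cnj_vec_root_space[OF v(1)] l(1) S root_space_mono[of "{cnj l}" S "complexify A"] by auto
    moreover have "of_real_vec (Re_vec v) = (1/2) *s (v + cnj_vec v)"
      "of_real_vec (Im_vec v) = (1/(2*\<i>)) *s (v - cnj_vec v)"
      by (simp_all add: of_real_vec_def Re_vec_def Im_vec_def cnj_vec_def vec_eq_iff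
          complex_eq_iff)
    ultimately have "of_real_vec x \<in> ?R"
      using v(2) by (metis root_space_scale root_space_add root_space_diff)
    then show "x \<in> of_real_vec -` ?R" by simp
  qed
  ultimately have "spectral_subspace A S \<subseteq> of_real_vec -` ?R"
    unfolding spectral_subspace_def by (metis span_minimal)
  then show ?thesis using assms(1) by blast
qed

lemma spectral_subspace_disjoint:
  assumes "x \<in> spectral_subspace A S" "x \<in> spectral_subspace A T" "S \<inter> T = {}"
    "cnj ` S \<subseteq> S" "cnj ` T \<subseteq> T"
  shows "x = 0"
proof -
  have "of_real_vec x = 0"
    using assms by (meson of_real_vec_spectral_subspace root_space_disjoint)
  then have "norm x = 0" by (metis norm_of_real_vec norm_zero)
  then show ?thesis by simp
qed

text \<open>Taking real parts of the complex decomposition suffices, as \<open>x\<close> is the real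
  part of its own embedding.\<close>

lemma spectral_subspace_sum:
  assumes "S \<union> T = UNIV"
  shows "\<exists>y\<in>spectral_subspace A S. \<exists>z\<in>spectral_subspace A T. x = y + z"
proof -
  let ?G = "\<lambda>S. \<Union>l\<in>{l \<in> spectrum A. l \<in> S}. real_gen_eigenspace A l"
  have "Re_vec v \<in> span (?G S \<union> ?G T)" if v: "v \<in> gen_eigenspace A l" for v l
  proof (cases "l \<in> spectrum A")
    case True
    then have "Re_vec v \<in> ?G S \<union> ?G T"
      using v assms by (auto simp: real_gen_eigenspace_eq)
    then show ?thesis by (rule span_base)
  next
    case False
    then have "Re_vec v = 0"
      using gen_eigenspace_not_spectrum[OF False v] by (simp add: Re_vec_def vec_eq_iff)
    then show ?thesis by (simp add: span_zero)
  qed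
  then have "Re_vec ` (\<Union>l. root_space (complexify A) {l}) \<subseteq> span (?G S \<union> ?G T)"
    by (auto simp: gen_eigenspace_eq)
  then have "span (Re_vec ` (\<Union>l. root_space (complexify A) {l})) \<subseteq> span (?G S \<union> ?G T)"
    by (rule span_minimal) simp
  then have "Re_vec ` root_space (complexify A) UNIV \<subseteq> span (?G S \<union> ?G T)"
    by (simp add: linear_span_image[OF linear_Re_vec] root_space_eq_span[of _ UNIV])
  then have "Re_vec (of_real_vec x) \<in> span (?G S \<union> ?G T)"
    unfolding root_space_UNIV by blast
  then show ?thesis
    by (auto simp: span_Un spectral_subspace_def)
qed

lemma summable_E_u:
  assumes "x \<in> E_u A" "A' ** A = mat 1"
  shows "summable (\<lambda>k. norm (mat_pow A' k *v x))"
proof -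
  have "of_real_vec x \<in> root_space (complexify A) {l. cmod l > 1}"
    using assms(1) by (intro of_real_vec_spectral_subspace) (auto simp: E_u_eq)
  moreover have "complexify A' ** complexify A = mat 1"
    using assms(2) by (simp add: complexify_mat_1 flip: complexify_mult)
  ultimately have "summable (\<lambda>k. norm (mat_pow (complexify A') k *v of_real_vec x))"
    by (intro summable_root_space) auto
  then show ?thesis
    by (simp add: mat_pow_complexify_of_real_vec norm_of_real_vec)
qed

lemma E_u_mult: "x \<in> E_u A \<Longrightarrow> A *v x \<in> E_u A"
  and E_sc_mult: "x \<in> E_sc A \<Longrightarrow> A *v x \<in> E_sc A"
  by (simp_all add: E_u_eq E_sc_eq spectral_subspace_mult)

lemma subspace_E_u: "subspace (E_u A)" and subspace_E_sc: "subspace (E_sc A)"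
  by (simp_all add: E_u_eq E_sc_eq subspace_spectral_subspace)

lemma E_u_Int_E_sc: "x \<in> E_u A \<Longrightarrow> x \<in> E_sc A \<Longrightarrow> x = 0"
  unfolding E_u_eq E_sc_eq by (erule (1) spectral_subspace_disjoint) auto

lemma E_u_sum_E_sc: "\<exists>y\<in>E_u A. \<exists>z\<in>E_sc A. x = y + z"
  unfolding E_u_eq E_sc_eq by (rule spectral_subspace_sum) auto

lemma unstable_proj_eq:
  assumes "y \<in> E_u A" "x - y \<in> E_sc A"
  shows "unstable_proj A x = y"
  unfolding unstable_proj_def
proof (rule the_equality)
  fix z assume z: "z \<in> E_u A \<and> x - z \<in> E_sc A"
  then have "z - y \<in> E_u A" "(x - y) - (x - z) \<in> E_sc A"
    using assms by (blast intro: subspace_diff subspace_E_u subspace_E_sc)+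
  then show "z = y" using E_u_Int_E_sc[of "z - y" A] by simp
qed (use assms in simp)

lemma unstable_proj_in: "unstable_proj A x \<in> E_u A"
  and unstable_proj_diff_in: "x - unstable_proj A x \<in> E_sc A"
proof -
  obtain y where "y \<in> E_u A" "x - y \<in> E_sc A"
    using E_u_sum_E_sc[of A x] by force
  then show "unstable_proj A x \<in> E_u A" "x - unstable_proj A x \<in> E_sc A"
    by (simp_all add: unstable_proj_eq)
qed

lemma linear_unstable_proj: "linear (unstable_proj A)"
proof (rule linearI)
  fix x y :: "real^'a" and c :: real
  have "x + y - (unstable_proj A x + unstable_proj A y) =
      (x - unstable_proj A x) + (y - unstable_proj A y)" by simp
  then show "unstable_proj A (x + y) = unstable_proj A x + unstable_proj A y"
    by (intro unstable_proj_eq)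
      (metis subspace_add subspace_E_u subspace_E_sc unstable_proj_in unstable_proj_diff_in)+
  have "c *\<^sub>R x - c *\<^sub>R unstable_proj A x = c *\<^sub>R (x - unstable_proj A x)"
    by (simp add: algebra_simps)
  then show "unstable_proj A (c *\<^sub>R x) = c *\<^sub>R unstable_proj A x"
    by (intro unstable_proj_eq)
      (metis subspace_scale subspace_E_u subspace_E_sc unstable_proj_in unstable_proj_diff_in)+
qed

lemma unstable_proj_mult: "unstable_proj A (A *v x) = A *v unstable_proj A x"
proof (rule unstable_proj_eq)
  have "A *v x - A *v unstable_proj A x = A *v (x - unstable_proj A x)"
    by (simp add: algebra_simps)
  then show "A *v x - A *v unstable_proj A x \<in> E_sc A"
    by (simp add: E_sc_mult unstable_proj_diff_in)
qed (simp add: E_u_mult unstable_proj_in)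

lemma unstable_proj_E_u: "x \<in> E_u A \<Longrightarrow> unstable_proj A x = x"
  by (rule unstable_proj_eq) (simp_all add: subspace_0 subspace_E_sc)

lemma unstable_proj_E_sc: "x \<in> E_sc A \<Longrightarrow> unstable_proj A x = 0"
  by (rule unstable_proj_eq) (simp_all add: subspace_0 subspace_E_u)

section \<open>Boundedness of the unstable part of the control set\<close>

lemma trajectory_0 [simp]: "trajectory A B 0 x u = x"
  by (simp add: trajectory_def)

lemma trajectory_Suc:
  "trajectory A B (Suc k) x u = A *v trajectory A B k x u + B *v u k"
proof -
  have "(\<Sum>i<k. (mat_pow A (k - i) ** B) *v u i) =
      A *v (\<Sum>i<k. (mat_pow A (k - 1 - i) ** B) *v u i)"
    unfolding linear_sum[OF matrix_vector_mul_linear]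
  proof (rule sum.cong)
    fix i assume "i \<in> {..<k}"
    then have "k - i = Suc (k - 1 - i)" by auto
    then show "(mat_pow A (k - i) ** B) *v u i = A *v ((mat_pow A (k - 1 - i) ** B) *v u i)"
      by (simp add: matrix_vector_mul_assoc matrix_mul_assoc)
  qed simp
  then show ?thesis
    by (simp add: trajectory_def algebra_simps matrix_vector_mul_assoc)
qed

text \<open>A norm on the unstable subspace that is expanded by \<open>A\<close>, composed with the projection.\<close>

definition unstable_norm :: "real^'d^'d \<Rightarrow> real^'d \<Rightarrow> real" where
  "unstable_norm A x = (\<Sum>k. norm (mat_pow (matrix_inv A) k *v unstable_proj A x))"

lemma matrix_inv_mult:
  assumes "invertible A"
  shows "matrix_inv A ** A = mat 1"
  using assms unfolding invertible_def matrix_inv_def by (rule someI2_ex) simp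

context
  fixes A :: "real^'d^'d"
  assumes A: "invertible A"
begin

lemma summable_unstable_norm:
  "summable (\<lambda>k. norm (mat_pow (matrix_inv A) k *v unstable_proj A x))"
  by (intro summable_E_u[of _ A] unstable_proj_in matrix_inv_mult A)

lemma unstable_norm_nonneg: "0 \<le> unstable_norm A x"
  unfolding unstable_norm_def by (intro suminf_nonneg summable_unstable_norm) simp

lemma norm_unstable_proj_le: "norm (unstable_proj A x) \<le> unstable_norm A x"
  using sum_le_suminf[OF summable_unstable_norm, of "{0}" x] by (simp add: unstable_norm_def)

lemma unstable_norm_triangle: "unstable_norm A (x + y) \<le> unstable_norm A x + unstable_norm A y"
  unfolding unstable_norm_def suminf_add[OF summable_unstable_norm summable_unstable_norm]
    linear_add[OF linear_unstable_proj]
  by (intro suminf_le summable_add summable_unstable_norm)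
    (simp_all add: matrix_vector_right_distrib norm_triangle_ineq
      summable_unstable_norm[of "x + y", unfolded linear_add[OF linear_unstable_proj]
        matrix_vector_right_distrib])

lemma unstable_norm_scale: "unstable_norm A (c *\<^sub>R x) = \<bar>c\<bar> * unstable_norm A x"
  unfolding unstable_norm_def linear_scale[OF linear_unstable_proj]
  by (simp add: matrix_vector_mult_scaleR suminf_mult summable_unstable_norm)

lemma unstable_norm_sum: "unstable_norm A (\<Sum>i\<in>I. f i) \<le> (\<Sum>i\<in>I. unstable_norm A (f i))"
proof (induction I rule: infinite_finite_induct)
  case (insert i I)
  then show ?case using unstable_norm_triangle[of "f i" "sum f I"] by simp
qed (use unstable_norm_scale[of 0 0] in simp_all)

lemma unstable_norm_bound: "\<exists>C>0. \<forall>x. unstable_norm A x \<le> C * norm x"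
proof (intro exI conjI allI)
  fix x :: "real^'d"
  have "unstable_norm A x = unstable_norm A (\<Sum>b\<in>Basis. (x \<bullet> b) *\<^sub>R b)"
    by (simp add: euclidean_representation)
  also have "\<dots> \<le> (\<Sum>b\<in>Basis. \<bar>x \<bullet> b\<bar> * unstable_norm A b)"
    using unstable_norm_sum[of "\<lambda>b. (x \<bullet> b) *\<^sub>R b" Basis] by (simp add: unstable_norm_scale)
  also have "\<dots> \<le> (\<Sum>b\<in>Basis. norm x * unstable_norm A b)"
    by (intro sum_mono mult_right_mono unstable_norm_nonneg Basis_le_norm)
  \<comment> \<open>The added 1 keeps the constant positive when \<open>E_u A\<close> is
    trivial.\<close>
  also have "\<dots> \<le> (1 + (\<Sum>b\<in>Basis. unstable_norm A b)) * norm x"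
    by (simp add: sum_distrib_left[symmetric] algebra_simps)
  finally show "unstable_norm A x \<le> (1 + (\<Sum>b\<in>Basis. unstable_norm A b)) * norm x" .
next
  show "0 < 1 + (\<Sum>b\<in>Basis. unstable_norm A b)"
    by (intro add_pos_nonneg sum_nonneg unstable_norm_nonneg) simp
qed

lemma continuous_on_unstable_norm: "continuous_on X (unstable_norm A)"
proof -
  obtain C where C: "C > 0" "\<And>x. unstable_norm A x \<le> C * norm x"
    using unstable_norm_bound by blast
  have "unstable_norm A x - unstable_norm A y \<le> C * norm (x - y)" for x y
    using unstable_norm_triangle[of y "x - y"] C(2)[of "x - y"] by simp
  then have "C-lipschitz_on X (unstable_norm A)"
    using C(1) by (intro lipschitz_onI) (auto simp: dist_norm abs_le_iff, metis norm_minus_commute)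
  then show ?thesis by (rule lipschitz_on_continuous_on)
qed

lemma unstable_norm_proj:
  assumes "unstable_proj A x = unstable_proj A y"
  shows "unstable_norm A x = unstable_norm A y"
  by (simp add: unstable_norm_def assms)

text \<open>Applying \<open>A\<close> moves the defining series by one place: a new first term
  appears and the remainder is the old series.\<close>

lemma unstable_norm_mult: "unstable_norm A (A *v x) = norm (A *v unstable_proj A x) + unstable_norm A x"
proof -
  have "mat_pow (matrix_inv A) (Suc k) *v (A *v y) = mat_pow (matrix_inv A) k *v y" for k y
    by (simp add: mat_pow_commute[symmetric] matrix_vector_mul_assoc matrix_mul_assoc[symmetric]
        matrix_inv_mult[OF A])
  then show ?thesis
    using suminf_split_head[OF summable_unstable_norm[of "A *v x"]]
    by (simp add: unstable_norm_def unstable_proj_mult)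
qed

text \<open>The new first term is at least \<open>unstable_norm A x / (C * K)\<close>, because the
  unstable norm is dominated by the Euclidean one and \<open>matrix_inv A\<close> is bounded. This
  yields the factor \<open>1 + 1 / (C * K)\<close>.\<close>

lemma unstable_norm_expand: "\<exists>q>1. \<forall>x. q * unstable_norm A x \<le> unstable_norm A (A *v x)"
proof -
  obtain C where C: "C > 0" "\<And>x. unstable_norm A x \<le> C * norm x"
    using unstable_norm_bound by blast
  obtain K where K: "K > 0" "\<And>x. norm (matrix_inv A *v x) \<le> norm x * K"
    using bounded_linear.pos_bounded[OF matrix_vector_mul_bounded_linear[of "matrix_inv A"]] by blast
  have "unstable_norm A x \<le> (C * K) * norm (A *v unstable_proj A x)" for x
  proof -
    have "unstable_norm A x = unstable_norm A (unstable_proj A x)"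
      by (intro unstable_norm_proj) (simp add: unstable_proj_E_u unstable_proj_in)
    also have "\<dots> \<le> C * norm (matrix_inv A *v (A *v unstable_proj A x))"
      using C(2) by (simp add: matrix_vector_mul_assoc matrix_inv_mult[OF A])
    also have "\<dots> \<le> C * (norm (A *v unstable_proj A x) * K)"
      by (intro mult_left_mono K(2)) (use C(1) in simp)
    finally show ?thesis by (simp add: mult_ac)
  qed
  then have "(1 + 1 / (C * K)) * unstable_norm A x \<le> unstable_norm A (A *v x)" for x
    unfolding unstable_norm_mult using C(1) K(1) by (simp add: field_simps)
  then show ?thesis
    using C(1) K(1) by (intro exI[of _ "1 + 1 / (C * K)"]) auto
qed

text \<open>Once the unstable norm is large the dynamics dominates the bounded control, so the unstable
  norm is increased by a fixed amount and never returns to its initial value.\<close>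

lemma unstable_norm_bounded_control_set:
  assumes "compact U" "control_set_properties A B U D"
  shows "\<exists>R. \<forall>x\<in>D. unstable_norm A x \<le> R"
proof -
  obtain q where q: "q > 1" "\<And>x. q * unstable_norm A x \<le> unstable_norm A (A *v x)"
    using unstable_norm_expand by blast
  have "compact ((\<lambda>w. unstable_norm A (B *v w)) ` U)"
    using assms(1) by (intro compact_continuous_image continuous_on_compose2[OF continuous_on_unstable_norm])
      (auto intro!: continuous_intros linear_continuous_on)
  then obtain c where c: "\<And>w. w \<in> U \<Longrightarrow> unstable_norm A (B *v w) \<le> c"
    using compact_imp_bounded[THEN bounded_imp_bdd_above] by (fastforce simp: bdd_above_def)
  have step: "q * unstable_norm A y - c \<le> unstable_norm A (A *v y + B *v w)" if "w \<in> U" for y w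
  proof -
    have "unstable_norm A (A *v y) \<le> unstable_norm A (A *v y + B *v w) + unstable_norm A (- (B *v w))"
      using unstable_norm_triangle[of "A *v y + B *v w" "- (B *v w)"] by simp
    also have "unstable_norm A (- (B *v w)) = unstable_norm A (B *v w)"
      using unstable_norm_scale[of "-1" "B *v w"] by simp
    finally show ?thesis using q(2)[of y] c[OF that] by linarith
  qed
  \<comment> \<open>The threshold is the fixed point of r -> \<open>q * r - c\<close>; above it one
    step strictly increases the lower bound.\<close>
  have "unstable_norm A x \<le> c / (q - 1)" if x: "x \<in> D" for x
  proof (rule ccontr)
    assume "\<not> ?thesis"
    then have big: "unstable_norm A x < q * unstable_norm A x - c"
      using q(1) by (simp add: field_simps)
    \<comment> \<open>The first conjunct carries the induction. The second gives a gap uniform in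
      \<open>k\<close> and \<open>u\<close>, which survives the closure of the reachable
      set.\<close>
    have "unstable_norm A x \<le> unstable_norm A (trajectory A B k x u) \<and>
        (1 \<le> k \<longrightarrow> q * unstable_norm A x - c \<le> unstable_norm A (trajectory A B k x u))"
      if u: "u \<in> controls U" for k u
    proof (induction k)
      case (Suc k)
      have "u k \<in> U" using u by (simp add: controls_def)
      then have "q * unstable_norm A (trajectory A B k x u) - c
          \<le> unstable_norm A (trajectory A B (Suc k) x u)"
        unfolding trajectory_Suc by (rule step)
      moreover have "q * unstable_norm A x \<le> q * unstable_norm A (trajectory A B k x u)"
        using Suc q(1) by simp
      ultimately show ?case using big by linarith
    qed simp
    then have "reachable_set A B U x \<subseteq> {y. q * unstable_norm A x - c \<le> unstable_norm A y}"
      by (auto simp: reachable_set_def)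
    moreover have "closed {y. q * unstable_norm A x - c \<le> unstable_norm A y}"
      by (intro closed_Collect_le continuous_on_const continuous_on_unstable_norm)
    ultimately have "closure (reachable_set A B U x) \<subseteq> {y. q * unstable_norm A x - c \<le> unstable_norm A y}"
      by (rule closure_minimal)
    moreover have "x \<in> closure (reachable_set A B U x)"
      using assms(2) x by (auto simp: control_set_properties_def)
    ultimately show False using big by auto
  qed
  then show ?thesis by blast
qed

end

section \<open>Volume growth and determinants on subspaces\<close>

text \<open>The change of variables theorems of the library require a well-ordered index type; every
  finite type has a well-ordered copy.\<close>

typedef 'a indexed = "UNIV :: 'a set" by simp

instance indexed :: (finite) finite
proof
  have "UNIV = range (Abs_indexed :: 'a \<Rightarrow> 'a indexed)"
    by (metis Abs_indexed_cases UNIV_eq_I rangeI)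
  then show "finite (UNIV :: 'a indexed set)" by (metis finite finite_imageI)
qed

instantiation indexed :: (finite) wellorder
begin

definition less_eq_indexed :: "'a indexed \<Rightarrow> 'a indexed \<Rightarrow> bool" where
  "x \<le> y \<longleftrightarrow> to_nat_on UNIV (Rep_indexed x) \<le> to_nat_on UNIV (Rep_indexed y)"

definition less_indexed :: "'a indexed \<Rightarrow> 'a indexed \<Rightarrow> bool" where
  "x < y \<longleftrightarrow> to_nat_on UNIV (Rep_indexed x) < to_nat_on UNIV (Rep_indexed y)"

instance
proof
  fix x y :: "'a indexed"
  assume "x \<le> y" "y \<le> x"
  then have "to_nat_on (UNIV :: 'a set) (Rep_indexed x) = to_nat_on UNIV (Rep_indexed y)"
    by (simp add: less_eq_indexed_def)
  then have "Rep_indexed x = Rep_indexed y"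
    by (rule inj_onD[OF inj_on_to_nat_on, OF countable_finite[OF finite] _ UNIV_I UNIV_I])
  then show "x = y" by (simp only: Rep_indexed_inject)
next
  fix P :: "'a indexed \<Rightarrow> bool" and a :: "'a indexed"
  assume step: "\<And>x. (\<And>y. y < x \<Longrightarrow> P y) \<Longrightarrow> P x"
  show "P a"
  proof (induction a rule: measure_induct_rule[of "\<lambda>x. to_nat_on UNIV (Rep_indexed x)"])
    case (less x)
    then show ?case by - (rule step, simp add: less_indexed_def)
  qed
qed (auto simp: less_eq_indexed_def less_indexed_def)

end

section \<open>Leibniz formulas indexed by a basis\<close>

lemma CARD_indexed: "CARD('a indexed) = CARD('a)"
  using type_definition.card[OF type_definition_indexed] by simp

text \<open>Conjugation by \<open>\<beta>\<close> carries permutations of the index type to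
  permutations of the basis and preserves signs. The transpose is taken because
  \<open>det_on\<close> lets the permutation act on the coordinate, not on the vector that is
  mapped.\<close>

lemma det_bij_basis:
  fixes M :: "real^'n^'n" and \<beta> :: "'n \<Rightarrow> 'v"
  assumes \<beta>: "bij_betw \<beta> UNIV B" and M: "\<And>i j. M $ i $ j = F (\<beta> j) (\<beta> i)"
  shows "det M = (\<Sum>p | p permutes B. of_int (sign p) * (\<Prod>v\<in>B. F v (p v)))"
proof -
  have inj: "inj \<beta>" and B: "B = range \<beta>" using \<beta> by (auto simp: bij_betw_def)
  let ?m = "map_permutation UNIV \<beta>"
  have bij: "bij_betw ?m {p. p permutes UNIV} {p. p permutes B}"
  proof -
    have "bij_betw (\<lambda>\<pi> x. if x \<in> B then \<beta> (\<pi> (inv_into UNIV \<beta> x)) else x)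
             {\<pi>. \<pi> permutes UNIV} {\<pi>. \<pi> permutes B}"
      by (rule bij_betw_permutations[OF \<beta>])
    also have "(\<lambda>\<pi> x. if x \<in> B then \<beta> (\<pi> (inv_into UNIV \<beta> x)) else x) = ?m"
      by (simp add: fun_eq_iff map_permutation_def restrict_id_def B)
    finally show ?thesis .
  qed
  have "det M = det (transpose M)" by (rule det_transpose[symmetric])
  also have "\<dots> = (\<Sum>p | p permutes (UNIV :: 'n set). of_int (sign p) * (\<Prod>i\<in>UNIV. F (\<beta> i) (\<beta> (p i))))"
    by (simp add: det_def transpose_def M)
  also have "\<dots> = (\<Sum>p | p permutes (UNIV :: 'n set).
      of_int (sign (?m p)) * (\<Prod>v\<in>B. F v (?m p v)))"
  proof (rule sum.cong)
    fix p assume p: "p \<in> {p. p permutes (UNIV :: 'n set)}"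
    have "(\<Prod>v\<in>B. F v (?m p v)) = (\<Prod>i\<in>UNIV. F (\<beta> i) (?m p (\<beta> i)))"
      unfolding B by (simp add: prod.reindex[OF inj])
    also have "\<dots> = (\<Prod>i\<in>UNIV. F (\<beta> i) (\<beta> (p i)))"
      by (simp add: map_permutation_def restrict_id_def inv_f_f[OF inj])
    finally show "of_int (sign p) * (\<Prod>i\<in>UNIV. F (\<beta> i) (\<beta> (p i))) =
        of_int (sign (?m p)) * (\<Prod>v\<in>B. F v (?m p v))"
      using p by (simp add: sign_map_permutation[OF inj])
  qed simp
  also have "\<dots> = (\<Sum>p | p permutes B. of_int (sign p) * (\<Prod>v\<in>B. F v (p v)))"
    by (rule sum.reindex_bij_betw[OF bij])
  finally show ?thesis .
qed

text \<open>This is a block triangular determinant with an identity block: a permutation moving a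
  point of \<open>b'\<close> meets a zero factor.\<close>

lemma sum_permutes_extend:
  fixes F :: "'v \<Rightarrow> 'v \<Rightarrow> real"
  assumes fin: "finite b" "finite b'" and disj: "b \<inter> b' = {}"
    and F: "\<And>v w. v \<in> b' \<Longrightarrow> F v w = (if w = v then 1 else 0)"
  shows "(\<Sum>p | p permutes (b \<union> b'). of_int (sign p) * (\<Prod>v\<in>b \<union> b'. F v (p v))) =
    (\<Sum>p | p permutes b. of_int (sign p) * (\<Prod>v\<in>b. F v (p v)))"
proof (rule sum.mono_neutral_cong_right)
  show "finite {p. p permutes b \<union> b'}" using fin by (simp add: finite_permutations)
  show "{p. p permutes b} \<subseteq> {p. p permutes b \<union> b'}" by (auto intro: permutes_subset)
  show "\<forall>p\<in>{p. p permutes b \<union> b'} - {p. p permutes b}.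
      of_int (sign p) * (\<Prod>v\<in>b \<union> b'. F v (p v)) = 0"
  proof
    fix p assume p: "p \<in> {p. p permutes b \<union> b'} - {p. p permutes b}"
    have "\<exists>v\<in>b'. p v \<noteq> v"
    proof (rule ccontr)
      assume "\<not> ?thesis"
      then have "p permutes b"
        using p by (intro permutes_superset[of p "b \<union> b'" b]) auto
      then show False using p by simp
    qed
    then obtain v where "v \<in> b'" "F v (p v) = 0" using F by auto
    then have "(\<Prod>v\<in>b \<union> b'. F v (p v)) = 0"
      using fin by (intro prod_zero) auto
    then show "of_int (sign p) * (\<Prod>v\<in>b \<union> b'. F v (p v)) = 0" by simp
  qed
  fix p assume p: "p \<in> {p. p permutes b}"
  have "(\<Prod>v\<in>b'. F v (p v)) = 1"
  proof (intro prod.neutral ballI)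
    fix v assume v: "v \<in> b'"
    then have "p v = v" using p disj by (intro permutes_not_in[of p b]) auto
    then show "F v (p v) = 1" using F[OF v] by simp
  qed
  then show "of_int (sign p) * (\<Prod>v\<in>b \<union> b'. F v (p v)) =
      of_int (sign p) * (\<Prod>v\<in>b. F v (p v))"
    using fin disj by (simp add: prod.union_disjoint)
qed

lemma independent_Un:
  fixes b b' :: "'a::euclidean_space set"
  assumes "independent b" "independent b'" "span b \<inter> span b' = {0}"
  shows "independent (b \<union> b')" "b \<inter> b' = {}"
proof -
  have fin: "finite b" "finite b'" using assms by (auto simp: independent_bound)
  show "b \<inter> b' = {}"
    using assms by (metis Int_iff dependent_zero disjoint_iff singletonD span_base)
  then have "card (b \<union> b') = dim b + dim b'"
    using fin assms by (simp add: card_Un_disjoint dim_eq_card_independent)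
  also have "\<dots> = dim (b \<union> b')"
    using dim_sums_Int[of "span b" "span b'"] assms(3) by (simp add: span_Un[symmetric])
  finally have "card (b \<union> b') = dim (span (b \<union> b'))" by simp
  then show "independent (b \<union> b')"
    using fin card_eq_dim[of "b \<union> b'" "span (b \<union> b')"] by (simp add: span_superset)
qed

text \<open>The coordinates are taken with respect to a basis of \<open>V\<close> (the one chosen in \<open>det_on\<close>)
  followed by a basis of \<open>W\<close>.\<close>

lemma ex_coordinates_det_on:
  fixes g :: "real^'d \<Rightarrow> real^'d"
  assumes V: "subspace V" and W: "subspace W" and VW: "V \<inter> W = {0}"
    and sum: "\<And>x. \<exists>y\<in>V. \<exists>z\<in>W. x = y + z"
    and g: "linear g" and gV: "\<And>x. x \<in> V \<Longrightarrow> g x \<in> V" and gW: "\<And>x. x \<in> W \<Longrightarrow> g x = x"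
  shows "\<exists>(h :: real^'d \<Rightarrow> real^'d indexed) M. linear h \<and> bij h \<and> (\<forall>x. h (g x) = M *v h x) \<and> det M = det_on V g"
proof -
  define b where "b = (SOME b. independent b \<and> span b = V)"
  have "\<exists>b. independent b \<and> span b = V"
    by (metis V basis_exists span_eq_iff span_mono subset_antisym)
  then have b: "independent b" "span b = V"
    unfolding b_def by (metis (mono_tags, lifting) someI_ex)+
  obtain b' where b': "independent b'" "span b' = W"
    by (metis W basis_exists span_eq_iff span_mono subset_antisym)
  define B where "B = b \<union> b'"
  have B: "independent B" and disj: "b \<inter> b' = {}"
    using independent_Un[of b b'] b b' VW by (auto simp: B_def)
  have "x \<in> span B" for x
    using sum[of x] b(2) b'(2) span_mono[of b B] span_mono[of b' B]
    by (auto simp: B_def intro!: span_add)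
  then have spB: "span B = UNIV" by blast
  have fin: "finite b" "finite b'" "finite B"
    using b b' B by (auto simp: independent_bound)
  have "card B = dim (span B)" using B by (simp add: dim_eq_card_independent)
  then have "card B = CARD('d indexed)" by (simp add: spB CARD_indexed)
  then obtain \<beta> :: "'d indexed \<Rightarrow> real^'d" where \<beta>: "bij_betw \<beta> UNIV B"
    using finite_same_card_bij[of "UNIV :: 'd indexed set" B] fin by auto
  have \<beta>_in: "\<beta> i \<in> B" for i using \<beta> by (auto simp: bij_betw_def)
  have inj: "inj \<beta>" using \<beta> by (auto simp: bij_betw_def)
  define h :: "real^'d \<Rightarrow> real^'d indexed" where "h x = (\<chi> i. representation B x (\<beta> i))" for x
  define M :: "real^'d indexed^'d indexed" where "M = (\<chi> i j. representation B (g (\<beta> j)) (\<beta> i))"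
  have h: "linear h"
    by (rule linearI) (simp_all add: h_def vec_eq_iff representation_add representation_scale B spB)
  have rep: "x = (\<Sum>j\<in>UNIV. h x $ j *\<^sub>R \<beta> j)" for x
  proof -
    have "(\<Sum>v\<in>B. representation B x v *\<^sub>R v) = x"
      by (rule sum_representation_eq) (auto simp: B spB fin)
    then show ?thesis
      using sum.reindex_bij_betw[OF \<beta>, of "\<lambda>v. representation B x v *\<^sub>R v"]
      by (simp add: h_def)
  qed
  have "h (\<Sum>j\<in>UNIV. y $ j *\<^sub>R \<beta> j) = y" for y
  proof -
    have "h (\<beta> j) = axis j 1" for j
      using inj_eq[OF inj] by (simp add: h_def axis_def representation_basis[OF B \<beta>_in])
    then show ?thesis
      unfolding linear_sum[OF h] linear_scale[OF h]
      by (simp add: basis_expansion flip: scalar_mult_eq_scaleR)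
  qed
  then have bij: "bij h"
    by (metis bijI' rep)
  have "h (g x) = M *v h x" for x
  proof -
    have "h (g x) = h (g (\<Sum>j\<in>UNIV. h x $ j *\<^sub>R \<beta> j))" using rep[of x] by simp
    also have "\<dots> = (\<Sum>j\<in>UNIV. h x $ j *\<^sub>R h (g (\<beta> j)))"
      by (simp add: linear_sum[OF g] linear_scale[OF g] linear_sum[OF h] linear_scale[OF h])
    also have "\<dots> = M *v h x"
      by (simp add: vec_eq_iff matrix_vector_mult_def M_def h_def mult.commute)
    finally show ?thesis .
  qed
  moreover have "det M = det_on V g"
  proof -
    let ?F = "\<lambda>v. representation B (g v)"
    have "det M = (\<Sum>p | p permutes B. of_int (sign p) * (\<Prod>v\<in>B. ?F v (p v)))"
      by (rule det_bij_basis[OF \<beta>]) (simp add: M_def)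
    also have "\<dots> = (\<Sum>p | p permutes b. of_int (sign p) * (\<Prod>v\<in>b. ?F v (p v)))"
      unfolding B_def
    proof (rule sum_permutes_extend[OF fin(1,2) disj])
      fix v w assume "v \<in> b'"
      then have "g v = v" "v \<in> B" using gW b'(2) span_base by (auto simp: B_def)
      then show "representation (b \<union> b') (g v) w = (if w = v then 1 else 0)"
        using representation_basis[OF B] by (simp add: B_def)
    qed
    also have "\<dots> = (\<Sum>p | p permutes b. of_int (sign p) * (\<Prod>v\<in>b. representation b (g v) (p v)))"
    proof (intro sum.cong arg_cong2[of _ _ _ _ "(*)"] prod.cong refl)
      fix p v assume "v \<in> b"
      then have "g v \<in> span b" using gV b(2) span_base by blast
      then show "representation B (g v) (p v) = representation b (g v) (p v)"
        using representation_extend[OF B, of "g v" b] by (simp add: B_def)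
    qed
    finally show ?thesis unfolding det_on_def Let_def b_def[symmetric] .
  qed
  ultimately show ?thesis using h bij by blast
qed

section \<open>Counting covering sets by volume\<close>

lemma det_mat_pow: "det (mat_pow M t) = det M ^ t" for M :: "real^'n^'n"
  by (induction t) (simp_all add: det_mul)

text \<open>Each of the covering sets is the preimage of \<open>W\<close> under an affine map of determinant
  \<open>(det M)\<^sup>t\<close>, so the number of sets grows at least like \<open>(det M)\<^sup>t\<close>.\<close>

lemma affine_preimage_cover_card:
  fixes h :: "real^'d \<Rightarrow> real^'n::{finite,wellorder}" and g :: "real^'d \<Rightarrow> real^'d"
  assumes h: "linear h" "bij h" and M: "\<And>x. h (g x) = M *v h x" and det: "det M \<noteq> 0"
    and K: "compact K" "\<not> negligible K" and W: "compact W"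
  shows "\<exists>c>0. \<forall>t F. finite F \<longrightarrow> K \<subseteq> (\<Union>w\<in>F. {x. (g ^^ t) x + w \<in> W}) \<longrightarrow>
    c * \<bar>det M\<bar> ^ t \<le> card F"
proof -
  have lc: "compact (h ` X)" if "compact X" for X
    using that h(1)
    by (intro compact_continuous_image linear_continuous_on) (simp_all add: linear_conv_bounded_linear)
  let ?m = "measure lebesgue :: (real^'n::_) set \<Rightarrow> real"
  define m1 m2 where "m1 = ?m (h ` K)" and "m2 = ?m (h ` W)"
  \<comment> \<open>The inverse of \<open>h\<close> is Lipschitz between spaces of equal dimension,
    so a null image of \<open>K\<close> would make \<open>K\<close> itself null.\<close>
  have "m1 \<noteq> 0"
  proof
    assume "m1 = 0"
    then have neg: "negligible (h ` K)"
      using lc[OF K(1)] by (simp add: m1_def negligible_iff_measure lmeasurable_compact)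
    obtain h' where h': "linear h'" "h' \<circ> h = id"
      using linear_injective_left_inverse[OF h(1)] h(2) by (auto simp: bij_def)
    have "dim (range h) = dim (UNIV :: (real^'d) set)"
      using h by (intro dim_image_eq) (auto simp: bij_def)
    then have "DIM(real^'n::_) = DIM(real^'d)"
      using h(2) by (simp add: bij_def)
    moreover obtain C where "\<And>x. norm (h' x) \<le> norm x * C"
      using bounded_linear.bounded[OF h'(1)[unfolded linear_conv_bounded_linear]] by blast
    then have "norm (h' y - h' x) \<le> C * norm (y - x)" for x y
      by (metis h'(1) linear_diff mult.commute)
    ultimately have "negligible (h' ` (h ` K))"
      using neg by - (rule negligible_locally_Lipschitz_image, simp, simp, blast)
    then show False using K(2) h'(2) by (simp add: image_comp)
  qed
  then have m1: "m1 > 0" by (simp add: m1_def zero_less_measure_iff)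
  have m2: "m2 \<ge> 0" by (simp add: m2_def)
  \<comment> \<open>\<open>W\<close> may be a null set; adding 1 keeps the denominator
    positive.\<close>
  have "m1 / (m2 + 1) * \<bar>det M\<bar> ^ t \<le> card F"
    if F: "finite F" "K \<subseteq> (\<Union>w\<in>F. {x. (g ^^ t) x + w \<in> W})" for t F
  proof -
    define P where "P = mat_pow M t"
    have P: "h ((g ^^ t) x) = P *v h x" for x
      unfolding P_def by (induction t) (simp_all add: M matrix_vector_mul_assoc[symmetric])
    have dP: "det P = det M ^ t" by (simp add: P_def det_mat_pow)
    then have "invertible P" using det by (simp add: invertible_det_nz)
    then obtain P' where P': "P ** P' = mat 1" "P' ** P = mat 1"
      unfolding invertible_def by blast
    \<comment> \<open>\<open>S w\<close> is the covering set of \<open>w\<close> in coordinates; its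
      measure does not depend on \<open>w\<close>.\<close>
    define X S where "X w = (\<lambda>y. y - h w) ` h ` W" and "S w = (*v) P' ` X w" for w
    have "compact (X w)" for w
      unfolding X_def by (intro compact_continuous_image continuous_intros lc W)
    then have cS: "compact (S w)" for w
      unfolding S_def by (intro compact_continuous_image linear_continuous_on) auto
    have "(*v) P ` S w = X w" for w
      by (simp add: S_def image_image matrix_vector_mul_assoc P')
    then have mS: "\<bar>det M\<bar> ^ t * ?m (S w) = m2" for w
      using measure_linear_image[of "(*v) P" "S w"] lmeasurable_compact[OF cS[of w]]
      by (simp add: dP X_def measure_translation_subtract m2_def power_abs)
    have "h ` K \<subseteq> (\<Union>w\<in>F. S w)"
    proof clarify
      fix x assume "x \<in> K"
      then obtain w where w: "w \<in> F" "(g ^^ t) x + w \<in> W" using F(2) by blast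
      have "P *v h x = h ((g ^^ t) x + w) - h w"
        by (simp add: linear_add[OF h(1)] P)
      then have "P *v h x \<in> X w" using w(2) unfolding X_def by blast
      then have "P' *v (P *v h x) \<in> S w" unfolding S_def by blast
      then show "h x \<in> (\<Union>w\<in>F. S w)"
        using w(1) by (auto simp: matrix_vector_mul_assoc P')
    qed
    then have "m1 \<le> ?m (\<Union>w\<in>F. S w)"
      unfolding m1_def using F(1)
      by (intro measure_mono_fmeasurable) (auto intro!: lmeasurable_compact fmeasurableD lc K cS compact_UN)
    also have "\<dots> \<le> (\<Sum>w\<in>F. ?m (S w))"
      using F(1) by (intro measure_UNION_le fmeasurableD lmeasurable_compact cS)
    finally have "m1 * \<bar>det M\<bar> ^ t \<le> (\<Sum>w\<in>F. ?m (S w)) * \<bar>det M\<bar> ^ t"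
      by (intro mult_right_mono) auto
    also have "\<dots> = card F * m2"
      by (simp add: sum_distrib_right mult.commute[of "?m _"] mS)
    also have "\<dots> \<le> card F * (m2 + 1)" by (intro mult_left_mono) auto
    finally show ?thesis using m2 by (simp add: field_simps)
  qed
  then show ?thesis using m1 m2 by (intro exI[of _ "m1 / (m2 + 1)"]) auto
qed

section \<open>The lower bound for the invariance pressure\<close>

lemma det_on_cong:
  fixes g g' :: "'a::euclidean_space \<Rightarrow> 'a"
  assumes V: "subspace V" and eq: "\<And>x. x \<in> V \<Longrightarrow> g x = g' x"
  shows "det_on V g = det_on V g'"
proof -
  define b where "b = (SOME b. independent b \<and> span b = V)"
  have "\<exists>b. independent b \<and> span b = V"
    by (metis V basis_exists span_eq_iff span_mono subset_antisym)
  then have "span b = V"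
    unfolding b_def by (metis (mono_tags, lifting) someI_ex)
  then have "g v = g' v" if "v \<in> b" for v
    using that eq span_base by blast
  then show ?thesis
    unfolding det_on_def Let_def b_def[symmetric] by simp
qed

lemma trajectory_affine: "trajectory A B k x u = mat_pow A k *v x + trajectory A B k 0 u"
  by (simp add: trajectory_def)

context
  fixes A :: "real^'d^'d"
  assumes A: "invertible A"
begin

text \<open>Being the identity on \<open>E_sc A\<close>, \<open>g\<close> contributes only its
  \<open>E_u A\<close> block to the determinant. It is injective because \<open>A\<close> is,
  applied to the unstable component first.\<close>

lemma unstable_coordinates:
  defines "g \<equiv> \<lambda>x. A *v unstable_proj A x + (x - unstable_proj A x)"
  shows "\<exists>(h :: real^'d \<Rightarrow> real^'d indexed) M. linear h \<and> bij h \<and> (\<forall>x. h (g x) = M *v h x) \<and>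
    det M \<noteq> 0 \<and> det M = det_on (E_u A) ((*v) A)"
proof -
  have g: "linear g"
    unfolding g_def
    by (intro linear_compose_add linear_compose_sub linear_ident linear_unstable_proj
        linear_compose[OF linear_unstable_proj matrix_vector_mul_linear, unfolded o_def])
  have g_u: "g x = A *v x" if "x \<in> E_u A" for x
    using that by (simp add: g_def unstable_proj_E_u)
  have "\<exists>(h :: real^'d \<Rightarrow> real^'d indexed) M. linear h \<and> bij h \<and> (\<forall>x. h (g x) = M *v h x) \<and>
      det M = det_on (E_u A) g"
  proof (rule ex_coordinates_det_on[OF subspace_E_u subspace_E_sc _ E_u_sum_E_sc g])
    show "E_u A \<inter> E_sc A = {0}"
      using E_u_Int_E_sc subspace_0[OF subspace_E_u] subspace_0[OF subspace_E_sc] by blast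
  qed (simp_all add: E_u_mult g_def unstable_proj_E_u unstable_proj_E_sc)
  then obtain h :: "real^'d \<Rightarrow> real^'d indexed" and M where
    h: "linear h" "bij h" "\<And>x. h (g x) = M *v h x" "det M = det_on (E_u A) g" by blast
  have inj_A: "x = 0" if "A *v x = 0" for x
    using that by (metis A matrix_inv_mult matrix_vector_mul_assoc matrix_vector_mul_lid
        matrix_vector_mult_0_right)
  have g0: "x = 0" if "g x = 0" for x
  proof -
    have "unstable_proj A (g x) = A *v unstable_proj A x"
      by (simp add: g_def linear_add[OF linear_unstable_proj] linear_diff[OF linear_unstable_proj]
          unstable_proj_mult unstable_proj_E_u unstable_proj_in)
    then have "unstable_proj A x = 0"
      using that inj_A by (simp add: linear_0[OF linear_unstable_proj])
    then show ?thesis using that by (simp add: g_def)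
  qed
  have "inj ((*v) M)"
  proof (rule linear_injective_0[THEN iffD2, rule_format])
    fix y assume y: "M *v y = 0"
    obtain x where x: "y = h x" using h(2) by (metis bij_pointE)
    have "h (g x) = h 0" using y x by (simp add: h(3) linear_0[OF h(1)])
    then show "y = 0" using h(2) g0 x by (metis bij_is_inj injD linear_0[OF h(1)])
  qed simp
  then have "det M \<noteq> 0"
    using det_nz_iff_inj[of "(*v) M"] by simp
  moreover have "det M = det_on (E_u A) ((*v) A)"
    unfolding h(4) by (rule det_on_cong[OF subspace_E_u g_u])
  ultimately show ?thesis using h by blast
qed

text \<open>The stable component is frozen in the cover below: replacing it by the identity makes the volume
  grow by exactly the unstable determinant, and the resulting orbits stay in a fixed compact set as
  the unstable norm is bounded on \<open>D\<close>.\<close>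

lemma spanning_card_ge:
  fixes B :: "real^'m^'d"
  assumes U: "compact U" and D: "control_set_properties A B U D"
    and K: "compact K" "\<not> negligible K"
  shows "\<exists>c>0. \<forall>t S. 1 \<le> t \<longrightarrow> finite S \<longrightarrow> spanning A B U t K D S \<longrightarrow>
    c * \<bar>det_on (E_u A) ((*v) A)\<bar> ^ t
      \<le> card {u \<in> S. \<exists>x\<in>K. \<forall>k\<in>{1..t}. trajectory A B k x u \<in> D}"
proof -
  let ?\<pi> = "unstable_proj A"
  note lin = linear_unstable_proj[of A]
  define g where "g = (\<lambda>x. A *v ?\<pi> x + (x - ?\<pi> x))"
  obtain h :: "real^'d \<Rightarrow> real^'d indexed" and M where h: "linear h" "bij h" "\<And>x. h (g x) = M *v h x"
    "det M \<noteq> 0" and M: "det M = det_on (E_u A) ((*v) A)"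
    using unstable_coordinates unfolding g_def by blast
  obtain R where R: "\<And>x. x \<in> D \<Longrightarrow> unstable_norm A x \<le> R"
    using unstable_norm_bounded_control_set[OF A U D] by blast
  have cont: "continuous_on X ?\<pi>" for X
    using lin by (simp add: linear_continuous_on linear_conv_bounded_linear)
  have "bounded ((\<lambda>x. x - ?\<pi> x) ` K)"
    by (intro compact_imp_bounded compact_continuous_image continuous_intros cont K)
  then obtain r where r: "\<And>x. x \<in> K \<Longrightarrow> norm (x - ?\<pi> x) \<le> r"
    unfolding bounded_iff by blast
  \<comment> \<open>\<open>r\<close> bounds the stable component on \<open>K\<close>, which
    \<open>g\<close> never changes; bounding both components makes \<open>W\<close> compact.\<close>
  define W where "W = {y. unstable_norm A y \<le> R \<and> norm (y - ?\<pi> y) \<le> r}"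
  have "norm y \<le> R + r" if "y \<in> W" for y
    using that norm_unstable_proj_le[OF A, of y] norm_triangle_ineq[of "?\<pi> y" "y - ?\<pi> y"]
    by (simp add: W_def)
  then have "bounded W" unfolding bounded_iff by blast
  moreover have "closed W"
    unfolding W_def
    by (intro closed_Collect_conj closed_Collect_le continuous_intros cont continuous_on_unstable_norm A)
  ultimately have "compact W" by (simp add: compact_eq_bounded_closed)
  then obtain c where c: "c > 0" "\<And>t F. finite F \<Longrightarrow> K \<subseteq> (\<Union>w\<in>F. {x. (g ^^ t) x + w \<in> W}) \<Longrightarrow>
      c * \<bar>det M\<bar> ^ t \<le> card F"
    using affine_preimage_cover_card[OF h K] by blast
  have idem: "?\<pi> (?\<pi> x) = ?\<pi> x" for x by (simp add: unstable_proj_E_u unstable_proj_in)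
  have g_step: "?\<pi> (g x) = A *v ?\<pi> x" "g x - ?\<pi> (g x) = x - ?\<pi> x" for x
    by (simp_all add: g_def linear_add[OF lin] linear_diff[OF lin] unstable_proj_mult idem)
  have pow: "?\<pi> ((g ^^ t) x) = ?\<pi> (mat_pow A t *v x) \<and> (g ^^ t) x - ?\<pi> ((g ^^ t) x) = x - ?\<pi> x" for t x
  proof (induction t)
    case (Suc t)
    have "(g ^^ Suc t) x - ?\<pi> ((g ^^ Suc t) x) = (g ^^ t) x - ?\<pi> ((g ^^ t) x)"
      by (simp only: funpow.simps o_apply g_step(2))
    moreover have "?\<pi> ((g ^^ Suc t) x) = ?\<pi> (mat_pow A (Suc t) *v x)"
      using Suc by (simp add: g_step(1) unstable_proj_mult matrix_vector_mul_assoc[symmetric])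
    ultimately show ?case using Suc by metis
  qed simp
  have "c * \<bar>det_on (E_u A) ((*v) A)\<bar> ^ t
      \<le> card {u \<in> S. \<exists>x\<in>K. \<forall>k\<in>{1..t}. trajectory A B k x u \<in> D}" (is "_ \<le> real (card ?S')")
    if t: "1 \<le> t" and S: "finite S" "spanning A B U t K D S" for t S
  proof -
    \<comment> \<open>The control enters the endpoint only as a translation, and only the unstable
      part of it is kept. Several controls may share a translation, so \<open>F\<close> can be
      smaller than the set of controls.\<close>
    define F where "F = (\<lambda>u. ?\<pi> (trajectory A B t 0 u)) ` ?S'"
    have "K \<subseteq> (\<Union>w\<in>F. {x. (g ^^ t) x + w \<in> W})"
    proof
      fix x assume x: "x \<in> K"
      then obtain u where u: "u \<in> S" "\<forall>k\<in>{1..t}. trajectory A B k x u \<in> D"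
        using S(2) by (auto simp: spanning_def)
      define w where "w = ?\<pi> (trajectory A B t 0 u)"
      have "w \<in> F" unfolding F_def w_def using u x by blast
      \<comment> \<open>The surrogate point has the unstable component of the true endpoint, which
        lies in \<open>D\<close>.\<close>
      have "?\<pi> ((g ^^ t) x + w) = ?\<pi> (trajectory A B t x u)"
        unfolding trajectory_affine[of A B t x u] linear_add[OF lin] by (simp add: pow w_def idem)
      then have "unstable_norm A ((g ^^ t) x + w) = unstable_norm A (trajectory A B t x u)"
        by (rule unstable_norm_proj[OF A])
      also have "\<dots> \<le> R" using u(2) t by (intro R) auto
      finally have "unstable_norm A ((g ^^ t) x + w) \<le> R" .
      moreover have "((g ^^ t) x + w) - ?\<pi> ((g ^^ t) x + w) = x - ?\<pi> x"
        using conjunct2[OF pow[of t x]] by (simp only: linear_add[OF lin] w_def idem) simp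
      ultimately have "(g ^^ t) x + w \<in> W" using r[OF x] by (simp add: W_def)
      then show "x \<in> (\<Union>w\<in>F. {x. (g ^^ t) x + w \<in> W})" using \<open>w \<in> F\<close> by blast
    qed
    then have "c * \<bar>det M\<bar> ^ t \<le> card F"
      using S(1) by (intro c(2)) (simp_all add: F_def)
    also have "card F \<le> card ?S'" unfolding F_def using S(1) by (intro card_image_le) simp
    finally show ?thesis by (simp add: M)
  qed
  then show ?thesis using c(1) by blast
qed

lemma det_on_E_u_nonzero: "det_on (E_u A) ((*v) A) \<noteq> 0"
  using unstable_coordinates by force

end

section \<open>From the number of controls to the pressure\<close>

lemma ext_ln_ge:
  assumes "0 < a" "ennreal a \<le> x"
  shows "ereal (ln a) \<le> ext_ln x"
proof (cases x)
  case (real r)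
  then have "a \<le> r" using assms by (simp add: ennreal_le_iff)
  then show ?thesis using real assms by (simp add: ext_ln_def ennreal_eq_0_iff)
next
  case top
  then show ?thesis by (simp add: ext_ln_def)
qed

text \<open>For finite \<open>S\<close> the useless controls are dropped, as \<open>avg\<close> says
  nothing about them. For infinite \<open>S\<close> every term is at least
  \<open>exp (- m * t)\<close>, so the sum is infinite.\<close>

lemma spanning_inf_ge:
  fixes A :: "real^'d^'d" and B :: "real^'m^'d" and a m s :: real
  assumes f: "\<And>w. w \<in> U \<Longrightarrow> - m \<le> f w"
    and avg: "\<And>x u. x \<in> K \<Longrightarrow> u \<in> controls U \<Longrightarrow> (\<forall>k\<in>{1..t}. trajectory A B k x u \<in> D) \<Longrightarrow>
      s \<le> birkhoff_sum t f u"
    and card: "\<And>S. finite S \<Longrightarrow> spanning A B U t K D S \<Longrightarrow>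
      a \<le> card {u \<in> S. \<exists>x\<in>K. \<forall>k\<in>{1..t}. trajectory A B k x u \<in> D}"
  shows "ennreal (a * exp s) \<le> spanning_inf A B U t f K D"
  unfolding spanning_inf_def
proof (rule INF_greatest)
  fix S assume "S \<in> {S. spanning A B U t K D S}"
  then have S: "spanning A B U t K D S" by simp
  then have SU: "S \<subseteq> controls U" by (simp add: spanning_def)
  let ?e = "\<lambda>u. ennreal (exp (birkhoff_sum t f u))"
  show "ennreal (a * exp s) \<le> (\<Sum>\<^sub>\<infinity>u\<in>S. ?e u)"
  proof (cases "finite S")
    case False
    have "ennreal (exp (- m * t)) \<le> ?e u" if "u \<in> S" for u
    proof -
      have "(\<Sum>i<t. - m) \<le> birkhoff_sum t f u"
        unfolding birkhoff_sum_def using that SU by (intro sum_mono f) (auto simp: controls_def)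
      then show ?thesis by (intro ennreal_leI) (simp add: mult.commute)
    qed
    then have "(\<Sum>\<^sub>\<infinity>u\<in>S. ?e u) = \<infinity>"
      using False by (intro infsum_superconst_infinite_ennreal[where b="ennreal (exp (- m * t))"]) auto
    then show ?thesis by simp
  next
    case True
    let ?S' = "{u \<in> S. \<exists>x\<in>K. \<forall>k\<in>{1..t}. trajectory A B k x u \<in> D}"
    have "a * exp s \<le> (\<Sum>u\<in>?S'. exp s)"
      using card[OF True S] by (simp add: mult_right_mono)
    also have "\<dots> \<le> (\<Sum>u\<in>?S'. exp (birkhoff_sum t f u))"
      using avg SU by (intro sum_mono) auto
    also have "\<dots> \<le> (\<Sum>u\<in>S. exp (birkhoff_sum t f u))"
      using True by (intro sum_mono2) auto
    finally have "ennreal (a * exp s) \<le> ennreal (\<Sum>u\<in>S. exp (birkhoff_sum t f u))"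
      by (rule ennreal_leI)
    also have "\<dots> = (\<Sum>\<^sub>\<infinity>u\<in>S. ?e u)" using True by simp
    finally show ?thesis .
  qed
qed

theorem proposition31:
  fixes A :: "real^'d^'d" and B :: "real^'m^'d"
    and U :: "(real^'m) set" and D K :: "(real^'d) set"
    and f :: "real^'m \<Rightarrow> real"
  assumes "invertible A"
    and "convex U" and "compact U" and "0 \<in> interior U" and "U = closure (interior U)"
    and "controllable A B"
    and "control_set A B U D" and "interior D \<noteq> {}"
    and "K \<subseteq> D" and "compact K"
    and "K \<in> lmeasurable" and "measure lebesgue K > 0"
    and "D \<in> lmeasurable" and "measure lebesgue D > 0"
    and "continuous_on U f"
  shows "invariance_pressure A B U f K D \<ge>
      ereal (ln \<bar>det_on (E_u A) ((*v) A)\<bar>) +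
      (INF (t, x, u) \<in> {(t, x, u). CARD('d) \<le> t \<and> x \<in> D \<and> u \<in> controls U \<and>
            (\<forall>i<t. unstable_proj A (trajectory A B i x u) \<in> unstable_proj A ` D)}.
        ereal (1 / real t * (\<Sum>i<t. f (u i))))"
proof -
  define L where "L = \<bar>det_on (E_u A) ((*v) A)\<bar>"
  define P where "P = {(t, x, u). CARD('d) \<le> t \<and> x \<in> D \<and> u \<in> controls U \<and>
            (\<forall>i<t. unstable_proj A (trajectory A B i x u) \<in> unstable_proj A ` D)}"
  define I where "I = (INF (t, x, u) \<in> P. ereal (1 / real t * (\<Sum>i<t. f (u i))))"
  have D: "control_set_properties A B U D"
    using assms(7) by (simp add: control_set_def)
  have L: "L > 0" using det_on_E_u_nonzero[OF assms(1)] by (simp add: L_def)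
  have "\<not> negligible K" using assms(12) by (auto simp: negligible_iff_measure)
  then obtain c where c: "c > 0" "\<And>t S. 1 \<le> t \<Longrightarrow> finite S \<Longrightarrow> spanning A B U t K D S \<Longrightarrow>
      c * L ^ t \<le> card {u \<in> S. \<exists>x\<in>K. \<forall>k\<in>{1..t}. trajectory A B k x u \<in> D}"
    using spanning_card_ge[OF assms(1,3) D assms(10)] unfolding L_def by blast
  have "bounded (f ` U)"
    using assms(3,15) by (intro compact_imp_bounded compact_continuous_image)
  then obtain m where m: "\<And>w. w \<in> U \<Longrightarrow> \<bar>f w\<bar> \<le> m"
    unfolding bounded_iff by auto
  \<comment> \<open>Spanning controls times \<open>1\<close> to \<open>t\<close>, the infimum asks
    for \<open>0\<close> to \<open>t - 1\<close>; time 0 is supplied by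
    \<open>x \<in> D\<close>.\<close>
  have P: "(t, x, u) \<in> P" if "CARD('d) \<le> t" "x \<in> D" "u \<in> controls U"
    "\<forall>k\<in>{1..t}. trajectory A B k x u \<in> D" for t x u
  proof -
    have "trajectory A B i x u \<in> D" if "i < t" for i
      using that \<open>x \<in> D\<close> \<open>\<forall>k\<in>{1..t}. trajectory A B k x u \<in> D\<close> by (cases i) auto
    then show ?thesis using that by (simp add: P_def)
  qed
  have card_pos: "1 \<le> CARD('d)" by (simp add: Suc_leI)
  have avg: "\<bar>1 / real t * (\<Sum>i<t. f (u i))\<bar> \<le> m" if "(t, x, u) \<in> P" for t x u
  proof -
    have "CARD('d) \<le> t" and u: "u i \<in> U" for i
      using that by (auto simp: P_def controls_def)
    then have t: "1 \<le> t" using card_pos order_trans by blast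
    have "\<bar>\<Sum>i<t. f (u i)\<bar> \<le> (\<Sum>i<t. m)"
      by (rule order_trans[OF sum_abs]) (intro sum_mono m u)
    then show ?thesis using t by (simp add: field_simps abs_mult)
  qed
  have "- ereal m \<le> I"
    unfolding I_def
  proof (rule INF_greatest)
    fix p assume p: "p \<in> P"
    obtain t x u where eq: "p = (t, x, u)" by (cases p)
    have "- m \<le> 1 / real t * (\<Sum>i<t. f (u i))"
      using avg p unfolding eq abs_le_iff by force
    then show "- ereal m \<le> (case p of (t, x, u) \<Rightarrow> ereal (1 / real t * (\<Sum>i<t. f (u i))))"
      by (simp add: eq)
  qed
  \<comment> \<open>\<open>I\<close> is below infinity only if the infimum is not over the empty
    set; a control staying in \<open>D\<close> forever provides a triple.\<close>
  moreover have "I \<le> ereal m"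
  proof -
    have "K \<noteq> {}" using assms(12) by auto
    then obtain x where x: "x \<in> D" using assms(9) by blast
    then obtain u where "u \<in> controls U" "\<forall>k\<ge>1. trajectory A B k x u \<in> D"
      using D unfolding control_set_properties_def by blast
    then have p: "(CARD('d), x, u) \<in> P" using x by (intro P) auto
    show ?thesis unfolding I_def by (rule INF_lower2[OF p]) (use abs_le_D1[OF avg[OF p]] in simp)
  qed
  ultimately obtain r where r: "I = ereal r" by (cases I) auto
  have r_le: "r \<le> 1 / real t * (\<Sum>i<t. f (u i))" if "(t, x, u) \<in> P" for t x u
  proof -
    have "I \<le> ereal (1 / real t * (\<Sum>i<t. f (u i)))"
      unfolding I_def using that by (intro INF_lower2[OF that]) simp
    then show ?thesis by (simp add: r)
  qed
  have bound: "ereal (ln c / real t + (ln L + r))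
      \<le> ereal (1 / real t) * ext_ln (spanning_inf A B U t f K D)" if t: "CARD('d) \<le> t" for t
  proof -
    have t1: "1 \<le> t" using card_pos t by (rule order_trans)
    \<comment> \<open>At least \<open>c * L ^ t\<close> useful controls, each with Birkhoff sum at
      least \<open>t * r\<close>.\<close>
    have "ennreal (c * L ^ t * exp (t * r)) \<le> spanning_inf A B U t f K D"
    proof (rule spanning_inf_ge)
      show "- m \<le> f w" if "w \<in> U" for w using m[OF that] by simp
      show "real t * r \<le> birkhoff_sum t f u" if "x \<in> K" "u \<in> controls U"
        "\<forall>k\<in>{1..t}. trajectory A B k x u \<in> D" for x u
        using r_le[OF P[OF t _ that(2,3)]] that(1) assms(9) t1
        by (auto simp: birkhoff_sum_def field_simps)
    qed (rule c(2)[OF t1])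
    then have "ereal (ln (c * L ^ t * exp (t * r))) \<le> ext_ln (spanning_inf A B U t f K D)"
      using c(1) L by (intro ext_ln_ge) simp_all
    also have "ln (c * L ^ t * exp (t * r)) = ln c + t * ln L + t * r"
      using c(1) L by (simp add: ln_mult ln_realpow)
    finally have "ereal (1 / real t) * ereal (ln c + t * ln L + t * r)
        \<le> ereal (1 / real t) * ext_ln (spanning_inf A B U t f K D)"
      by (intro ereal_mult_left_mono) simp_all
    moreover have "ereal (1 / real t) * ereal (ln c + t * ln L + t * r) = ereal (ln c / real t + (ln L + r))"
      using t1 by (simp add: field_simps)
    ultimately show ?thesis by simp
  qed
  have "(\<lambda>t. ln c / real t + (ln L + r)) \<longlonglongrightarrow> 0 + (ln L + r)"
    by (intro tendsto_add tendsto_const lim_const_over_n)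
  then have "(\<lambda>t. ereal (ln c / real t + (ln L + r))) \<longlonglongrightarrow> ereal (ln L + r)"
    by simp
  then have "ereal (ln L + r) = limsup (\<lambda>t. ereal (ln c / real t + (ln L + r)))"
    by (intro lim_imp_Limsup[symmetric]) simp_all
  also have "\<dots> \<le> invariance_pressure A B U f K D"
    unfolding invariance_pressure_def
    by (intro Limsup_mono eventually_sequentiallyI[of "CARD('d)"] bound)
  finally show ?thesis
    unfolding P_def[symmetric] I_def[symmetric] L_def[symmetric] r by simp
qed

end
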